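(* Let $\xi$ be an unbiased estimator of the drift. For every $\alpha\in(0,1)$, $$\mathbb{E}^u\Big[\|\xi-u\|^2_{W^{\alpha,2}_0}\Big]\;\ge\;\int_0^T\int_0^T\frac{1}{|t-s|^{2\alpha}}\,dt\,ds,\qquad\text{for every }u\in\Theta .$$ Equality is attained by the (efficient) estimator $\xi=X$. (Both sides take values in $[0,+\infty]$.)
   Context: Fix $T>0$ and let $X=(X_t)_{t\in[0,T]}$ be a Brownian motion on a filtered probability space $(\Omega,\mathcal{F},(\mathcal{F}_t)_{t\in[0,T]},\mathbb{P})$. $H^1_0=H^1_0(0,T)$ denotes the space of functions $h(t)=\int_0^t\dot h(s)\,ds$, $t\in[0,T]$, with $\dot h\in L^2(0,T)$ (only vanishing at $t=0$ is required). The parameter space $\Theta$ is a (nonempty) set of absolutely continuous adapted processes $u_t=\int_0^t\dot u_s\,ds$, $t\in[0,T]$, such that $\dot u$ satisfies the conditions of Girsanov's theorem: $\dot u$ is adapted, $\int_0^T\dot u_s^2\,ds<\infty$ a.s., and, with $$L^u:=\exp\Big[\int_0^T\dot u_s\,dX_s-\tfrac12\int_0^T\dot u_s^2\,ds\Big],$$ $\mathbb{P}^u:=L^u\,\mathbb{P}$ is a probability measure under which $X^u_t:=X_t-u_t$ is a Brownian motion on $[0,T]$. $\mathbb{E}^u$ denotes expectation under $\mathbb{P}^u$. It is assumed that $u+h\in\Theta$ for every $u\in\Theta$ and every (deterministic) $h\in H^1_0$, and that $u_t$ is $\mathbb{P}^u$-integrable for all $u\in\Theta$, $t\in[0,T]$.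 An estimator of the drift is any measurable stochastic process $\xi:\Omega\times[0,T]\to\mathbb{R}$ (not depending on $u$, not necessarily adapted). It is unbiased if, for every $u\in\Theta$ and $t\in[0,T]$, $\xi_t$ is $\mathbb{P}^u$-integrable and $\mathbb{E}^u[\xi_t]=\mathbb{E}^u[u_t]$. For $\alpha\in(0,1)$ and a measurable function $f:[0,T]\to\mathbb{R}$, the fractional Sobolev energy is $$\|f\|^2_{W^{\alpha,2}_0}:=\int_0^T\int_0^T\frac{|f_t-f_s|^2}{|t-s|^{2\alpha+1}}\,dt\,ds\in[0,+\infty].$$ *)

theory Defs
  imports "HOL-Probability.Probability"
begin

text \<open>A process on the time interval [0,T] is a function \<open>Y :: real \<Rightarrow> 'a \<Rightarrow> real\<close> (time first); its values
  at times outside [0,T] are never used.\<close>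

definition filtered_prob_space :: "'a measure \<Rightarrow> (real \<Rightarrow> 'a measure) \<Rightarrow> real \<Rightarrow> bool" where
  "filtered_prob_space M F T \<longleftrightarrow>
     prob_space M \<and>
     (\<forall>t\<in>{0..T}. subalgebra M (F t)) \<and>
     (\<forall>s t. 0 \<le> s \<and> s \<le> t \<and> t \<le> T \<longrightarrow> subalgebra (F t) (F s))"

definition measurable_process :: "'a measure \<Rightarrow> real \<Rightarrow> (real \<Rightarrow> 'a \<Rightarrow> real) \<Rightarrow> bool" where
  "measurable_process M T Y \<longleftrightarrow>
     (\<lambda>(\<omega>, t). Y t \<omega>) \<in> borel_measurable (M \<Otimes>\<^sub>M restrict_space borel {0..T})"

definition adapted_process :: "(real \<Rightarrow> 'a measure) \<Rightarrow> real \<Rightarrow> (real \<Rightarrow> 'a \<Rightarrow> real) \<Rightarrow> bool" where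
  "adapted_process F T Y \<longleftrightarrow> (\<forall>t\<in>{0..T}. Y t \<in> borel_measurable (F t))"

text \<open>Standard Brownian motion with respect to the filtration. Paths are only required to be continuous
  almost surely, with no completeness of the filtration; joint measurability, automatic when all paths
  are continuous, is therefore listed separately.\<close>

definition brownian_motion ::
    "'a measure \<Rightarrow> (real \<Rightarrow> 'a measure) \<Rightarrow> real \<Rightarrow> (real \<Rightarrow> 'a \<Rightarrow> real) \<Rightarrow> bool" where
  "brownian_motion M F T X \<longleftrightarrow>
     measurable_process M T X \<and> adapted_process F T X \<and>
     (AE \<omega> in M. X 0 \<omega> = 0) \<and>
     (AE \<omega> in M. continuous_on {0..T} (\<lambda>t. X t \<omega>)) \<and>
     (\<forall>s t. 0 \<le> s \<and> s < t \<and> t \<le> T \<longrightarrow>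
        distributed M lborel (\<lambda>\<omega>. X t \<omega> - X s \<omega>) (normal_density 0 (sqrt (t - s))) \<and>
        prob_space.indep_set M (sets (F s))
          (sets (vimage_algebra (space M) (\<lambda>\<omega>. X t \<omega> - X s \<omega>) borel)))"

text \<open>The Ito integral is built as usual. A simple integrand is \<open>\<Sum>i<n. Z i * 1\<^bsub>(\<tau> i, \<tau> (i+1)]\<^esub>\<close> with
  \<open>Z i\<close> bounded and measurable at time \<open>\<tau> i\<close>; a random variable is a version of the integral of \<open>\<phi>\<close> if it
  is the limit in probability of the integrals of some sequence of simple integrands \<open>\<Phi> n\<close> for which
  the integral of \<open>(\<Phi> n - \<phi>)\<^sup>2\<close> over [0,T] tends to 0 in probability. Such a version exists for every
  jointly measurable adapted \<open>\<phi>\<close> that is a.s. square integrable on [0,T], and it is a.s. unique.\<close>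

definition simple_integrand ::
    "(real \<Rightarrow> 'a measure) \<Rightarrow> real \<Rightarrow> nat \<Rightarrow> (nat \<Rightarrow> real) \<Rightarrow> (nat \<Rightarrow> 'a \<Rightarrow> real) \<Rightarrow> bool" where
  "simple_integrand F T n \<tau> Z \<longleftrightarrow>
     (\<forall>i<n. 0 \<le> \<tau> i \<and> \<tau> i \<le> \<tau> (Suc i) \<and> \<tau> (Suc i) \<le> T \<and>
        Z i \<in> borel_measurable (F (\<tau> i)) \<and> (\<exists>B. \<forall>\<omega>\<in>space (F (\<tau> i)). \<bar>Z i \<omega>\<bar> \<le> B))"

definition simple_process :: "nat \<Rightarrow> (nat \<Rightarrow> real) \<Rightarrow> (nat \<Rightarrow> 'a \<Rightarrow> real) \<Rightarrow> real \<Rightarrow> 'a \<Rightarrow> real" where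
  "simple_process n \<tau> Z s \<omega> = (\<Sum>i<n. Z i \<omega> * indicator {\<tau> i<..\<tau> (Suc i)} s)"

definition simple_integral ::
    "(real \<Rightarrow> 'a \<Rightarrow> real) \<Rightarrow> nat \<Rightarrow> (nat \<Rightarrow> real) \<Rightarrow> (nat \<Rightarrow> 'a \<Rightarrow> real) \<Rightarrow> 'a \<Rightarrow> real" where
  "simple_integral X n \<tau> Z \<omega> = (\<Sum>i<n. Z i \<omega> * (X (\<tau> (Suc i)) \<omega> - X (\<tau> i) \<omega>))"

definition is_ito_integral ::
    "'a measure \<Rightarrow> (real \<Rightarrow> 'a measure) \<Rightarrow> real \<Rightarrow> (real \<Rightarrow> 'a \<Rightarrow> real) \<Rightarrow> (real \<Rightarrow> 'a \<Rightarrow> real)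
      \<Rightarrow> ('a \<Rightarrow> real) \<Rightarrow> bool" where
  "is_ito_integral M F T X \<phi> I \<longleftrightarrow>
     I \<in> borel_measurable M \<and>
     (\<exists>N \<tau> Z. (\<forall>n. simple_integrand F T (N n) (\<tau> n) (Z n)) \<and>
        (\<forall>\<epsilon>>0. (\<lambda>n. measure M {\<omega>\<in>space M. ennreal \<epsilon> <
            (\<integral>\<^sup>+s\<in>{0..T}. ennreal ((simple_process (N n) (\<tau> n) (Z n) s \<omega> - \<phi> s \<omega>)\<^sup>2) \<partial>lborel)})
          \<longlonglongrightarrow> 0) \<and>
        (\<forall>\<epsilon>>0. (\<lambda>n. measure M {\<omega>\<in>space M.
            \<epsilon> < \<bar>simple_integral X (N n) (\<tau> n) (Z n) \<omega> - I \<omega>\<bar>}) \<longlonglongrightarrow> 0))"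

definition ito_integrable ::
    "'a measure \<Rightarrow> (real \<Rightarrow> 'a measure) \<Rightarrow> real \<Rightarrow> (real \<Rightarrow> 'a \<Rightarrow> real) \<Rightarrow> (real \<Rightarrow> 'a \<Rightarrow> real) \<Rightarrow> bool" where
  "ito_integrable M F T X \<phi> \<longleftrightarrow> (\<exists>I. is_ito_integral M F T X \<phi> I)"

definition ito_integral ::
    "'a measure \<Rightarrow> (real \<Rightarrow> 'a measure) \<Rightarrow> real \<Rightarrow> (real \<Rightarrow> 'a \<Rightarrow> real) \<Rightarrow> (real \<Rightarrow> 'a \<Rightarrow> real) \<Rightarrow> 'a \<Rightarrow> real" where
  "ito_integral M F T X \<phi> = (SOME I. is_ito_integral M F T X \<phi> I)"

definition is_drift_derivative ::
    "'a measure \<Rightarrow> (real \<Rightarrow> 'a measure) \<Rightarrow> real \<Rightarrow> (real \<Rightarrow> 'a \<Rightarrow> real) \<Rightarrow> (real \<Rightarrow> 'a \<Rightarrow> real) \<Rightarrow> bool" where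
  "is_drift_derivative M F T u v \<longleftrightarrow>
     measurable_process M T v \<and> adapted_process F T v \<and>
     (AE \<omega> in M. (\<integral>\<^sup>+s\<in>{0..T}. ennreal ((v s \<omega>)\<^sup>2) \<partial>lborel) < \<infinity>) \<and>
     (AE \<omega> in M. \<forall>t\<in>{0..T}. u t \<omega> = (LINT s:{0..t}|lborel. v s \<omega>))"

text \<open>Any two derivatives of the same drift agree almost everywhere in (time, \<omega>), so the choice does not
  affect the Girsanov density below up to null sets, nor the measure it defines.\<close>

definition drift_derivative ::
    "'a measure \<Rightarrow> (real \<Rightarrow> 'a measure) \<Rightarrow> real \<Rightarrow> (real \<Rightarrow> 'a \<Rightarrow> real) \<Rightarrow> real \<Rightarrow> 'a \<Rightarrow> real" where
  "drift_derivative M F T u = (SOME v. is_drift_derivative M F T u v)"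

definition girsanov_density ::
    "'a measure \<Rightarrow> (real \<Rightarrow> 'a measure) \<Rightarrow> real \<Rightarrow> (real \<Rightarrow> 'a \<Rightarrow> real) \<Rightarrow> (real \<Rightarrow> 'a \<Rightarrow> real) \<Rightarrow> 'a \<Rightarrow> real" where
  "girsanov_density M F T X u \<omega> =
     exp (ito_integral M F T X (drift_derivative M F T u) \<omega>
          - 1/2 * (LINT s:{0..T}|lborel. (drift_derivative M F T u s \<omega>)\<^sup>2))"

definition girsanov_measure ::
    "'a measure \<Rightarrow> (real \<Rightarrow> 'a measure) \<Rightarrow> real \<Rightarrow> (real \<Rightarrow> 'a \<Rightarrow> real) \<Rightarrow> (real \<Rightarrow> 'a \<Rightarrow> real) \<Rightarrow> 'a measure" where
  "girsanov_measure M F T X u = density M (\<lambda>\<omega>. ennreal (girsanov_density M F T X u \<omega>))"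

text \<open>Integrability in the Ito sense follows from the existence of a drift derivative; it is listed only
  to guarantee that the stochastic integral in the Girsanov density is not an arbitrary value.\<close>

definition girsanov_drift ::
    "'a measure \<Rightarrow> (real \<Rightarrow> 'a measure) \<Rightarrow> real \<Rightarrow> (real \<Rightarrow> 'a \<Rightarrow> real) \<Rightarrow> (real \<Rightarrow> 'a \<Rightarrow> real) \<Rightarrow> bool" where
  "girsanov_drift M F T X u \<longleftrightarrow>
     measurable_process M T u \<and> adapted_process F T u \<and>
     (\<exists>v. is_drift_derivative M F T u v) \<and>
     ito_integrable M F T X (drift_derivative M F T u) \<and>
     prob_space (girsanov_measure M F T X u) \<and>
     brownian_motion (girsanov_measure M F T X u) F T (\<lambda>t \<omega>. X t \<omega> - u t \<omega>)"

definition H10 :: "real \<Rightarrow> (real \<Rightarrow> real) set" where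
  "H10 T = {h. \<exists>k. k \<in> borel_measurable borel \<and> set_integrable lborel {0..T} (\<lambda>s. (k s)\<^sup>2) \<and>
                (\<forall>t\<in>{0..T}. h t = (LINT s:{0..t}|lborel. k s))}"

text \<open>Closure under deterministic shifts is stated up to irrelevant values of processes outside
  [0,T] or outside the sample space.\<close>

definition drift_parameter_space ::
    "'a measure \<Rightarrow> (real \<Rightarrow> 'a measure) \<Rightarrow> real \<Rightarrow> (real \<Rightarrow> 'a \<Rightarrow> real) \<Rightarrow> (real \<Rightarrow> 'a \<Rightarrow> real) set \<Rightarrow> bool" where
  "drift_parameter_space M F T X \<Theta> \<longleftrightarrow>
     \<Theta> \<noteq> {} \<and>
     (\<forall>u\<in>\<Theta>. girsanov_drift M F T X u) \<and>
     (\<forall>u\<in>\<Theta>. \<forall>h\<in>H10 T. \<exists>w\<in>\<Theta>. \<forall>t\<in>{0..T}. \<forall>\<omega>\<in>space M. w t \<omega> = u t \<omega> + h t) \<and>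
     (\<forall>u\<in>\<Theta>. \<forall>t\<in>{0..T}. integrable (girsanov_measure M F T X u) (u t))"

definition unbiased_drift_estimator ::
    "'a measure \<Rightarrow> (real \<Rightarrow> 'a measure) \<Rightarrow> real \<Rightarrow> (real \<Rightarrow> 'a \<Rightarrow> real) \<Rightarrow> (real \<Rightarrow> 'a \<Rightarrow> real) set
      \<Rightarrow> (real \<Rightarrow> 'a \<Rightarrow> real) \<Rightarrow> bool" where
  "unbiased_drift_estimator M F T X \<Theta> \<xi> \<longleftrightarrow>
     measurable_process M T \<xi> \<and>
     (\<forall>u\<in>\<Theta>. \<forall>t\<in>{0..T}.
        integrable (girsanov_measure M F T X u) (\<xi> t) \<and>
        (LINT \<omega>|girsanov_measure M F T X u. \<xi> t \<omega>) = (LINT \<omega>|girsanov_measure M F T X u. u t \<omega>))"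

text \<open>On the diagonal the integrand is 0 by the conventions for division and \<open>powr\<close>; this is a null set.\<close>

definition sobolev_energy :: "real \<Rightarrow> real \<Rightarrow> (real \<Rightarrow> real) \<Rightarrow> ennreal" where
  "sobolev_energy T \<alpha> f =
     (\<integral>\<^sup>+s\<in>{0..T}. (\<integral>\<^sup>+t\<in>{0..T}.
        ennreal (\<bar>f t - f s\<bar>\<^sup>2 / \<bar>t - s\<bar> powr (2 * \<alpha> + 1)) \<partial>lborel) \<partial>lborel)"

definition drift_risk ::
    "'a measure \<Rightarrow> (real \<Rightarrow> 'a measure) \<Rightarrow> real \<Rightarrow> (real \<Rightarrow> 'a \<Rightarrow> real) \<Rightarrow> real
      \<Rightarrow> (real \<Rightarrow> 'a \<Rightarrow> real) \<Rightarrow> (real \<Rightarrow> 'a \<Rightarrow> real) \<Rightarrow> ennreal" where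
  "drift_risk M F T X \<alpha> \<xi> u =
     (\<integral>\<^sup>+\<omega>. sobolev_energy T \<alpha> (\<lambda>t. \<xi> t \<omega> - u t \<omega>) \<partial>girsanov_measure M F T X u)"

end

theory Submission
  imports Defs
begin

text \<open>
  The statement is an integrated Cramer--Rao inequality for Gaussian shifts. Fix \<open>u \<in> \<Theta>\<close> and
  \<open>a \<le> b\<close>, and write \<open>Z\<close> for the increment of \<open>\<xi> - u\<close> over \<open>[a,b]\<close> and \<open>D\<close> for that of \<open>X - u\<close>. By
  Fubini the risk is the double integral of \<open>\<bbbE>\<^sup>u[Z\<^sup>2]\<close> against \<open>1 / (b - a)\<^bsup>2\<alpha>+1\<^esup>\<close>, so it suffices to show
  \<open>\<bbbE>\<^sup>u[Z\<^sup>2] \<ge> b - a\<close> for every unbiased \<open>\<xi>\<close>. For \<open>\<xi> = X\<close> this holds with equality, since then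
  \<open>Z = D\<close> is a Brownian increment under \<open>\<bbbP>\<^sup>u\<close>.

  To bound \<open>\<bbbE>\<^sup>u[Z\<^sup>2]\<close>, perturb \<open>u\<close> by \<open>\<epsilon>\<close> times the ramp that rises with slope one on \<open>[a,b]\<close>. The new
  drift is in \<open>\<Theta>\<close>, and its Girsanov measure has density \<open>R\<^sub>\<epsilon> = exp (\<epsilon> D - \<epsilon>\<^sup>2 (b - a) / 2)\<close> with respect to
  \<open>\<bbbP>\<^sup>u\<close> (\<open>girsanov_density_ramp_shift\<close>). Unbiasedness at the new drift says \<open>\<bbbE>\<^sup>u[Z R\<^sub>\<epsilon>] = \<epsilon> (b - a)\<close>, and
  \<open>\<bbbE>\<^sup>u[R\<^sub>\<epsilon>\<^sup>2] = exp (\<epsilon>\<^sup>2 (b - a))\<close>; expanding \<open>\<bbbE>\<^sup>u[(Z - (R\<^sub>\<epsilon> - 1) / \<epsilon>)\<^sup>2] \<ge> 0\<close> and letting \<open>\<epsilon> \<rightarrow> 0\<close> gives the bound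
  (\<open>gaussian_shift_information_bound\<close>). Finite increments in \<open>\<epsilon>\<close> replace the differentiation under the
  expectation of the usual Cramer--Rao argument.

  The formula for \<open>R\<^sub>\<epsilon>\<close> is where stochastic integration enters: the drift derivative and the stochastic
  integral in a Girsanov density are arbitrary choices, so one has to show that they depend on the
  drift only up to null sets. For the derivative this is uniqueness of densities on \<open>[0,T]\<close>. For the
  integral, \<open>ito_integral_step_shift\<close> shows that adding a deterministic step \<open>\<epsilon> 1\<^bsub>(a,b]\<^esub>\<close> to an integrand adds
  \<open>\<epsilon> (X\<^sub>b - X\<^sub>a)\<close> to any version of the integral; it rests on the inequality
  \<open>\<bbbP>(|\<integral>H dX| > \<eta>) \<le> \<bbbP>(\<integral>H\<^sup>2 dt > \<delta>) + \<delta> / \<eta>\<^sup>2\<close> for elementary integrands \<open>H\<close>.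
\<close>

section \<open>Elementary stochastic integrals\<close>

text \<open>This passes between an integrand given on arbitrary intervals \<open>(a,b]\<close> and its values on the cells of a
  common grid. With \<open>f\<close> a path of \<open>X\<close> it regroups the integral, and with \<open>f\<close> the indicator of
  \<open>[s,\<infinity>)\<close> it regroups the integrand at time \<open>s\<close>.\<close>

lemma telescope_on_grid:
  fixes p :: "nat \<Rightarrow> real" and f :: "real \<Rightarrow> 'b::ab_group_add"
  assumes mono: "strict_mono_on {..m} p" and a: "a \<in> p ` {..m}" and b: "b \<in> p ` {..m}" and "a \<le> b"
  shows "(\<Sum>j<m. if a \<le> p j \<and> p (Suc j) \<le> b then f (p (Suc j)) - f (p j) else 0) = f b - f a"
proof -
  obtain i k where i: "i \<le> m" "a = p i" and k: "k \<le> m" "b = p k" using a b by auto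
  have le: "p x \<le> p y \<longleftrightarrow> x \<le> y" if "x \<le> m" "y \<le> m" for x y
    using strict_mono_on_less_eq[OF mono] that by auto
  have "i \<le> k" using le i k \<open>a \<le> b\<close> by auto
  have "(\<Sum>j<m. if a \<le> p j \<and> p (Suc j) \<le> b then f (p (Suc j)) - f (p j) else 0)
     = (\<Sum>j<m. if i \<le> j \<and> j < k then f (p (Suc j)) - f (p j) else 0)"
    by (intro sum.cong) (auto simp: i k le Suc_le_eq)
  also have "\<dots> = (\<Sum>j\<in>{j\<in>{..<m}. i \<le> j \<and> j < k}. f (p (Suc j)) - f (p j))"
    by (rule sum.inter_filter[symmetric]) simp
  also have "{j\<in>{..<m}. i \<le> j \<and> j < k} = {i..<k}" using k by auto
  also have "(\<Sum>j\<in>{i..<k}. f (p (Suc j)) - f (p j)) = f (p k) - f (p i)"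
    using sum_Suc_diff'[OF \<open>i \<le> k\<close>, of "\<lambda>j. f (p j)"] by simp
  finally show ?thesis by (simp add: i k)
qed

lemma finite_set_grid:
  fixes P :: "real set"
  assumes "finite P" "P \<noteq> {}"
  obtains m p where "strict_mono_on {..m} p" "P = p ` {..m::nat}"
proof -
  let ?l = "sorted_list_of_set P"
  have n: "length ?l > 0" using assms by (simp add: card_gt_0_iff)
  have "strict_mono_on {..length ?l - 1} (\<lambda>i. ?l ! i)"
    by (intro strict_mono_onI sorted_wrt_nth_less[OF strict_sorted_list_of_set])
      (use n in auto)
  moreover have "P = (\<lambda>i. ?l ! i) ` {..length ?l - 1}"
  proof -
    have "P = set ?l" using assms by simp
    also have "\<dots> = (\<lambda>i. ?l ! i) ` {..<length ?l}"
      by (simp add: set_conv_nth image_def Bex_def lessThan_def) blast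
    also have "{..<length ?l} = {..length ?l - 1}" using n by auto
    finally show ?thesis .
  qed
  ultimately show ?thesis by (rule that)
qed

text \<open>The setting is used twice: for \<open>X\<close> under the reference measure, and for \<open>X - u\<close> under the Girsanov
  measure of a drift \<open>u\<close>.\<close>

locale filtered_brownian =
  fixes M :: "'a measure" and F :: "real \<Rightarrow> 'a measure" and T :: real and X :: "real \<Rightarrow> 'a \<Rightarrow> real"
  assumes filtered: "filtered_prob_space M F T" and brownian: "brownian_motion M F T X"
begin

sublocale prob_space M using filtered by (simp add: filtered_prob_space_def)

lemma subalgebra_filtration: "0 \<le> s \<Longrightarrow> s \<le> T \<Longrightarrow> subalgebra M (F s)"
  using filtered by (simp add: filtered_prob_space_def)

lemma subalgebra_filtration_mono: "0 \<le> s \<Longrightarrow> s \<le> t \<Longrightarrow> t \<le> T \<Longrightarrow> subalgebra (F t) (F s)"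
  using filtered by (simp add: filtered_prob_space_def)

lemma measurable_mono: 
  assumes "0 \<le> s" "s \<le> t" "t \<le> T" "f \<in> borel_measurable (F s)"
  shows "f \<in> borel_measurable (F t)"
  by (rule measurable_from_subalg[OF subalgebra_filtration_mono[OF assms(1-3)] assms(4)])

lemma measurable_from_filtration: 
  assumes "0 \<le> s" "s \<le> T" "f \<in> borel_measurable (F s)"
  shows "f \<in> borel_measurable M"
  by (rule measurable_from_subalg[OF subalgebra_filtration[OF assms(1-2)] assms(3)])

lemma space_filtration: "0 \<le> s \<Longrightarrow> s \<le> T \<Longrightarrow> space (F s) = space M"
  using subalgebra_filtration[of s] by (simp add: subalgebra_def)

lemma adapted: 
  assumes "0 \<le> s" "s \<le> t" "t \<le> T" 
  shows "X s \<in> borel_measurable (F t)"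
proof (rule measurable_mono[OF assms])
  show "X s \<in> borel_measurable (F s)"
    using brownian assms by (simp add: brownian_motion_def adapted_process_def)
qed

lemma X_measurable: "0 \<le> s \<Longrightarrow> s \<le> T \<Longrightarrow> X s \<in> borel_measurable M"
  by (rule measurable_from_filtration[OF _ _ adapted]) simp_all

lemma increment:
  assumes "0 \<le> s" "s \<le> t" "t \<le> T"
  shows integrable_increment: "integrable M (\<lambda>\<omega>. X t \<omega> - X s \<omega>)"
    and expectation_increment: "expectation (\<lambda>\<omega>. X t \<omega> - X s \<omega>) = 0"
    and integrable_increment_sq: "integrable M (\<lambda>\<omega>. (X t \<omega> - X s \<omega>)\<^sup>2)"
    and expectation_increment_sq: "expectation (\<lambda>\<omega>. (X t \<omega> - X s \<omega>)\<^sup>2) = t - s"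
proof -
  have "integrable M (\<lambda>\<omega>. X t \<omega> - X s \<omega>) \<and> expectation (\<lambda>\<omega>. X t \<omega> - X s \<omega>) = 0 \<and>
    integrable M (\<lambda>\<omega>. (X t \<omega> - X s \<omega>)\<^sup>2) \<and> expectation (\<lambda>\<omega>. (X t \<omega> - X s \<omega>)\<^sup>2) = t - s"
  proof (cases "s = t")
    case False
    then have "s < t" using assms by simp
    then have D: "distributed M lborel (\<lambda>\<omega>. X t \<omega> - X s \<omega>) (normal_density 0 (sqrt (t - s)))"
      using brownian assms by (auto simp: brownian_motion_def)
    have pos: "sqrt (t - s) > 0" using \<open>s < t\<close> by simp
    note i = distributed_integrable[OF D, symmetric]
    have 1: "integrable M (\<lambda>\<omega>. X t \<omega> - X s \<omega>)"
      using i[of "\<lambda>x. x"] integrable_normal_moment_nz_1[OF pos, of 0] by simp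
    have 2: "integrable M (\<lambda>\<omega>. (X t \<omega> - X s \<omega>)\<^sup>2)"
      using i[of "\<lambda>x. x^2"] integrable_normal_moment[OF pos, of 0 2] by simp
    have 3: "expectation (\<lambda>\<omega>. X t \<omega> - X s \<omega>) = 0"
      using normal_distributed_expectation[OF pos D] .
    have 4: "expectation (\<lambda>\<omega>. (X t \<omega> - X s \<omega>)\<^sup>2) = t - s"
      using normal_distributed_variance[OF pos D] 3 assms by simp
    from 1 2 3 4 show ?thesis by (intro conjI)
  qed simp
  then show "integrable M (\<lambda>\<omega>. X t \<omega> - X s \<omega>)" "expectation (\<lambda>\<omega>. X t \<omega> - X s \<omega>) = 0"
    "integrable M (\<lambda>\<omega>. (X t \<omega> - X s \<omega>)\<^sup>2)" "expectation (\<lambda>\<omega>. (X t \<omega> - X s \<omega>)\<^sup>2) = t - s"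
    by simp_all
qed

lemma indep_increment:
  assumes "0 \<le> s" "s < t" "t \<le> T" "f \<in> borel_measurable (F s)"
  shows "indep_var borel f borel (\<lambda>\<omega>. X t \<omega> - X s \<omega>)"
proof -
  let ?D = "\<lambda>\<omega>. X t \<omega> - X s \<omega>"
  have ind: "indep_set (sets (F s)) (sets (vimage_algebra (space M) ?D borel))"
    using brownian assms by (auto simp: brownian_motion_def)
  have sp: "space (F s) = space M" using space_filtration assms by auto
  have D: "?D \<in> borel_measurable M"
    using X_measurable[of s] X_measurable[of t] assms by auto
  have "sigma_sets (space M) {f -` A \<inter> space M |A. A \<in> sets borel} \<subseteq> sets (F s)"
    unfolding sp[symmetric] by (intro sets.sigma_sets_subset) (use assms(4) in auto)
  moreover have "sets (vimage_algebra (space M) ?D borel) 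
      = sigma_sets (space M) {?D -` A \<inter> space M |A. A \<in> sets borel}"
    by (subst sets_vimage_algebra) simp
  ultimately have "indep_set (sigma_sets (space M) {f -` A \<inter> space M |A. A \<in> sets borel})
     (sigma_sets (space M) {?D -` A \<inter> space M |A. A \<in> sets borel})"
    using ind unfolding indep_set_def
    by (elim indep_sets_mono_sets) (auto split: bool.split)
  then show ?thesis
    unfolding indep_var_eq 
    by (intro conjI D measurable_from_filtration[OF _ _ assms(4)]) (use assms(1-3) in linarith)+
qed

lemma indep_increment_product:
  assumes "0 \<le> s" "s < t" "t \<le> T" "f \<in> borel_measurable (F s)" "integrable M f"
  shows "integrable M (\<lambda>\<omega>. f \<omega> * (X t \<omega> - X s \<omega>))" "expectation (\<lambda>\<omega>. f \<omega> * (X t \<omega> - X s \<omega>)) = 0"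
proof -
  have i: "integrable M (\<lambda>\<omega>. X t \<omega> - X s \<omega>)" "expectation (\<lambda>\<omega>. X t \<omega> - X s \<omega>) = 0"
    by (rule increment; use assms(1-3) in simp)+
  note ind = indep_increment[OF assms(1-4)]
  show "integrable M (\<lambda>\<omega>. f \<omega> * (X t \<omega> - X s \<omega>))" 
    using indep_var_integrable[OF ind assms(5) i(1)] .
  show "expectation (\<lambda>\<omega>. f \<omega> * (X t \<omega> - X s \<omega>)) = 0"
    using indep_var_lebesgue_integral[OF ind assms(5) i(1)] i(2) by simp
qed

lemma indep_increment_product_sq:
  assumes "0 \<le> s" "s < t" "t \<le> T" "f \<in> borel_measurable (F s)" "integrable M (\<lambda>\<omega>. (f \<omega>)\<^sup>2)"
  shows "integrable M (\<lambda>\<omega>. (f \<omega> * (X t \<omega> - X s \<omega>))\<^sup>2)" 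
    "expectation (\<lambda>\<omega>. (f \<omega> * (X t \<omega> - X s \<omega>))\<^sup>2) = (t - s) * expectation (\<lambda>\<omega>. (f \<omega>)\<^sup>2)"
proof -
  have i: "integrable M (\<lambda>\<omega>. (X t \<omega> - X s \<omega>)\<^sup>2)" "expectation (\<lambda>\<omega>. (X t \<omega> - X s \<omega>)\<^sup>2) = t - s"
    by (rule increment; use assms(1-3) in simp)+
  have ind: "indep_var borel (\<lambda>\<omega>. (f \<omega>)\<^sup>2) borel (\<lambda>\<omega>. (X t \<omega> - X s \<omega>)\<^sup>2)"
    using indep_var_compose[OF indep_increment[OF assms(1-4)], of "\<lambda>x. x\<^sup>2" borel "\<lambda>x. x\<^sup>2" borel] 
    by (simp add: comp_def)
  show "integrable M (\<lambda>\<omega>. (f \<omega> * (X t \<omega> - X s \<omega>))\<^sup>2)" 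
    using indep_var_integrable[OF ind assms(5) i(1)] by (simp add: power_mult_distrib)
  show "expectation (\<lambda>\<omega>. (f \<omega> * (X t \<omega> - X s \<omega>))\<^sup>2) = (t - s) * expectation (\<lambda>\<omega>. (f \<omega>)\<^sup>2)"
    using indep_var_lebesgue_integral[OF ind assms(5) i(1)] i(2) by (simp add: power_mult_distrib)
qed

text \<open>By induction on the number of cells: the new increment is independent of the past at the
  left endpoint of its cell, so the cross term has mean zero. Measurability of the partial sum at the
  time \<open>p n\<close> is carried along because this independence needs it.\<close>

lemma ito_isometry_on_grid:
  assumes grid: "strict_mono_on {..m} p" "p ` {..m::nat} \<subseteq> {0..T}"
    and W: "\<And>j. j < m \<Longrightarrow> W j \<in> borel_measurable (F (p j))"
    and B: "\<And>j \<omega>. j < m \<Longrightarrow> \<omega> \<in> space M \<Longrightarrow> \<bar>W j \<omega>\<bar> \<le> B"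
  defines "S \<equiv> \<lambda>n \<omega>. \<Sum>j<n. W j \<omega> * (X (p (Suc j)) \<omega> - X (p j) \<omega>)"
  assumes "n \<le> m"
  shows "S n \<in> borel_measurable (F (p n)) \<and> integrable M (\<lambda>\<omega>. (S n \<omega>)\<^sup>2) \<and>
     expectation (\<lambda>\<omega>. (S n \<omega>)\<^sup>2) = expectation (\<lambda>\<omega>. \<Sum>j<n. (W j \<omega>)\<^sup>2 * (p (Suc j) - p j))"
  using \<open>n \<le> m\<close>
proof (induction n)
  case 0
  then show ?case by (simp add: S_def)
next
  case (Suc n)
  then have IH: "S n \<in> borel_measurable (F (p n))" "integrable M (\<lambda>\<omega>. (S n \<omega>)\<^sup>2)"
     "expectation (\<lambda>\<omega>. (S n \<omega>)\<^sup>2) = expectation (\<lambda>\<omega>. \<Sum>j<n. (W j \<omega>)\<^sup>2 * (p (Suc j) - p j))"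
    by auto
  have n: "n < m" using Suc by simp
  have p: "0 \<le> p n" "p n < p (Suc n)" "p (Suc n) \<le> T"
    using grid n by (auto simp: strict_mono_on_def image_subset_iff)
  let ?D = "\<lambda>\<omega>. X (p (Suc n)) \<omega> - X (p n) \<omega>"
  have S: "S (Suc n) = (\<lambda>\<omega>. S n \<omega> + W n \<omega> * ?D \<omega>)"
    by (auto simp: S_def)
  have meas: "S (Suc n) \<in> borel_measurable (F (p (Suc n)))"
    unfolding S using measurable_mono[OF _ _ _ IH(1)] measurable_mono[OF _ _ _ W[OF n]] p
      adapted[of "p n" "p (Suc n)"] adapted[of "p (Suc n)" "p (Suc n)"] by auto
  have WM: "W j \<in> borel_measurable M" if "j < m" for j
    using W[OF that] measurable_from_filtration[of "p j"] grid(2) that by (auto simp: image_subset_iff)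
  have W2: "integrable M (\<lambda>\<omega>. (W j \<omega>)\<^sup>2)" if "j < m" for j
  proof (rule integrable_const_bound[where B="B\<^sup>2"])
    show "AE \<omega> in M. norm ((W j \<omega>)\<^sup>2) \<le> B\<^sup>2"
    proof (rule AE_I2)
      fix \<omega> assume "\<omega> \<in> space M"
      from power_mono[OF B[OF that this], of 2] show "norm ((W j \<omega>)\<^sup>2) \<le> B\<^sup>2" by simp
    qed
  qed (use WM that in auto)
  have SM: "S n \<in> borel_measurable M" using measurable_from_filtration[OF _ _ IH(1)] p by auto
  have S1: "integrable M (S n)"
    by (rule square_integrable_imp_integrable[OF SM IH(2)])
  have SW: "integrable M (\<lambda>\<omega>. S n \<omega> * W n \<omega>)"
  proof (rule Bochner_Integration.integrable_bound[of _ "\<lambda>\<omega>. B * S n \<omega>"])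
    show "AE \<omega> in M. norm (S n \<omega> * W n \<omega>) \<le> norm (B * S n \<omega>)"
    proof (rule AE_I2)
      fix \<omega> assume "\<omega> \<in> space M"
      with B[OF n this] show "norm (S n \<omega> * W n \<omega>) \<le> norm (B * S n \<omega>)" 
        by (simp add: abs_mult mult.commute[of "\<bar>S n \<omega>\<bar>"] mult_right_mono)
    qed
  qed (use SM WM n S1 in auto)
  have cross: "integrable M (\<lambda>\<omega>. (S n \<omega> * W n \<omega>) * ?D \<omega>)" "expectation (\<lambda>\<omega>. (S n \<omega> * W n \<omega>) * ?D \<omega>) = 0"
    using indep_increment_product[OF p, of "\<lambda>\<omega>. S n \<omega> * W n \<omega>"] IH(1) W[OF n] SW by auto
  have sq: "integrable M (\<lambda>\<omega>. (W n \<omega> * ?D \<omega>)\<^sup>2)" 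
    "expectation (\<lambda>\<omega>. (W n \<omega> * ?D \<omega>)\<^sup>2) = (p (Suc n) - p n) * expectation (\<lambda>\<omega>. (W n \<omega>)\<^sup>2)"
    using indep_increment_product_sq[OF p W[OF n]] W2[OF n] by auto
  have e: "(\<lambda>\<omega>. (S (Suc n) \<omega>)\<^sup>2) = (\<lambda>\<omega>. (S n \<omega>)\<^sup>2 + 2 * (S n \<omega> * W n \<omega> * ?D \<omega>) + (W n \<omega> * ?D \<omega>)\<^sup>2)"
    by (auto simp: S power2_eq_square algebra_simps)
  have int: "integrable M (\<lambda>\<omega>. (S (Suc n) \<omega>)\<^sup>2)"
    unfolding e using IH cross sq by auto
  have "expectation (\<lambda>\<omega>. (S (Suc n) \<omega>)\<^sup>2) = expectation (\<lambda>\<omega>. (S n \<omega>)\<^sup>2) + (p (Suc n) - p n) * expectation (\<lambda>\<omega>. (W n \<omega>)\<^sup>2)"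
    unfolding e using IH(2) cross sq by simp
  also have "\<dots> = expectation (\<lambda>\<omega>. \<Sum>j<Suc n. (W j \<omega>)\<^sup>2 * (p (Suc j) - p j))"
  proof -
    have "expectation (\<lambda>\<omega>. \<Sum>j<k. (W j \<omega>)\<^sup>2 * (p (Suc j) - p j)) 
        = (\<Sum>j<k. expectation (\<lambda>\<omega>. (W j \<omega>)\<^sup>2) * (p (Suc j) - p j))" if "k \<le> m" for k
      using that W2 by (subst Bochner_Integration.integral_sum) auto
    from this[of n] this[of "Suc n"] show ?thesis
      unfolding IH(3) using Suc.prems by simp
  qed
  finally show ?case using meas int by blast
qed

text \<open>Truncation reduces the claim to the isometry. The coefficient on cell \<open>j\<close> is switched off as soon as
  the accumulated energy, the current cell included, exceeds \<open>\<delta>\<close>; that energy is known at time \<open>p j\<close>,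
  so the integrand stays admissible. Its energy is at most \<open>\<delta>\<close> everywhere, and it agrees with the original
  integrand wherever the total energy is at most \<open>\<delta>\<close>. Chebyshev's inequality does the rest.\<close>

lemma grid_integral_tail_bound:
  assumes grid: "strict_mono_on {..m} p" "p ` {..m::nat} \<subseteq> {0..T}"
    and W: "\<And>j. j < m \<Longrightarrow> W j \<in> borel_measurable (F (p j))"
    and B: "\<And>j \<omega>. j < m \<Longrightarrow> \<omega> \<in> space M \<Longrightarrow> \<bar>W j \<omega>\<bar> \<le> B"
    and pos: "\<delta> > 0" "\<eta> > 0"
  shows "prob {\<omega>\<in>space M. \<eta> < \<bar>\<Sum>j<m. W j \<omega> * (X (p (Suc j)) \<omega> - X (p j) \<omega>)\<bar>}
     \<le> prob {\<omega>\<in>space M. \<delta> < (\<Sum>j<m. (W j \<omega>)\<^sup>2 * (p (Suc j) - p j))} + \<delta> / \<eta>\<^sup>2"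
proof -
  define Q where "Q = (\<lambda>n \<omega>. \<Sum>j<n. (W j \<omega>)\<^sup>2 * (p (Suc j) - p j))"
  \<comment> \<open>The truncation uses the energy through cell \<open>j\<close>, which is known at its left endpoint.\<close>
  define V where "V = (\<lambda>j \<omega>. if Q (Suc j) \<omega> \<le> \<delta> then W j \<omega> else 0)"
  have p: "0 \<le> p n" "p n \<le> T" if "n \<le> m" for n
    using grid that by (auto simp: image_subset_iff)
  have p_less: "p i < p j" if "i < j" "j \<le> m" for i j
    using grid that by (auto simp: strict_mono_on_def)
  have Wk: "W i \<in> borel_measurable (F (p j))" if "i \<le> j" "j < m" for i j
    using W[of i] measurable_mono[of "p i" "p j" "W i"] p[of i] p[of j] p_less[of i j] that
    by (cases "i = j") auto
  have Qmeas: "Q (Suc j) \<in> borel_measurable (F (p j))" if "j < m" for j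
    unfolding Q_def using that by (intro borel_measurable_sum) (auto intro!: borel_measurable_times borel_measurable_power Wk)
  have V: "V j \<in> borel_measurable (F (p j))" if "j < m" for j
    unfolding V_def using Qmeas[OF that] W[OF that] by measurable
  have VB: "\<bar>V j \<omega>\<bar> \<le> max B 0" if "j < m" "\<omega> \<in> space M" for j \<omega>
    unfolding V_def using B[OF that] by auto
  define S where "S = (\<lambda>\<omega>. \<Sum>j<m. V j \<omega> * (X (p (Suc j)) \<omega> - X (p j) \<omega>))"
  have S: "S \<in> borel_measurable (F (p m))" "integrable M (\<lambda>\<omega>. (S \<omega>)\<^sup>2)"
     "expectation (\<lambda>\<omega>. (S \<omega>)\<^sup>2) = expectation (\<lambda>\<omega>. \<Sum>j<m. (V j \<omega>)\<^sup>2 * (p (Suc j) - p j))"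
    unfolding S_def using ito_isometry_on_grid[OF grid, of V "max B 0" m] V VB by auto
  have SM: "S \<in> borel_measurable M" 
    using measurable_from_filtration[OF _ _ S(1)] p by auto
  have Qmono: "Q i \<omega> \<le> Q j \<omega>" if "i \<le> j" "j \<le> m" for i j \<omega>
    unfolding Q_def using that by (intro sum_mono2) (auto intro!: mult_nonneg_nonneg less_imp_le[OF p_less])
  have VQ: "n \<le> m \<Longrightarrow> (\<Sum>j<n. (V j \<omega>)\<^sup>2 * (p (Suc j) - p j)) \<le> min \<delta> (Q n \<omega>)" for n \<omega>
  proof (induction n)
    case 0 then show ?case using pos by (simp add: Q_def)
  next
    case (Suc n)
    have "Q n \<omega> + (W n \<omega>)\<^sup>2 * (p (Suc n) - p n) = Q (Suc n) \<omega>" by (simp add: Q_def)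
    moreover have "Q n \<omega> \<le> Q (Suc n) \<omega>" using Qmono Suc by auto
    ultimately show ?case using Suc by (auto simp: V_def)
  qed
  have WM: "W j \<in> borel_measurable M" if "j < m" for j
    using W[OF that] measurable_from_filtration[of "p j"] p[of j] that by (auto simp: image_subset_iff)
  have VM: "V j \<in> borel_measurable M" if "j < m" for j
    using V[OF that] measurable_from_filtration[of "p j"] p[of j] that by (auto simp: image_subset_iff)
  have QM: "Q m \<in> borel_measurable M" 
    unfolding Q_def by (intro borel_measurable_sum) (auto intro!: borel_measurable_times borel_measurable_power WM)
  have "expectation (\<lambda>\<omega>. \<Sum>j<m. (V j \<omega>)\<^sup>2 * (p (Suc j) - p j)) \<le> \<delta>"
  proof -
    have "expectation (\<lambda>\<omega>. \<Sum>j<m. (V j \<omega>)\<^sup>2 * (p (Suc j) - p j)) \<le> expectation (\<lambda>\<omega>. \<delta>)"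
    proof (rule integral_mono')
      show "(\<Sum>j<m. (V j \<omega>)\<^sup>2 * (p (Suc j) - p j)) \<le> \<delta>" for \<omega> using VQ[of m \<omega>] by auto
    qed (use pos in auto)
    then show ?thesis by (simp add: prob_space)
  qed
  with S(3) have ES: "expectation (\<lambda>\<omega>. (S \<omega>)\<^sup>2) \<le> \<delta>" by simp
  have Vm: "(\<lambda>\<omega>. \<Sum>j<m. W j \<omega> * (X (p (Suc j)) \<omega> - X (p j) \<omega>)) \<in> borel_measurable M"
    using X_measurable p WM by (intro borel_measurable_sum) (auto intro!: borel_measurable_times borel_measurable_diff)
  have agree: "(\<Sum>j<m. W j \<omega> * (X (p (Suc j)) \<omega> - X (p j) \<omega>)) = S \<omega>" if "Q m \<omega> \<le> \<delta>" for \<omega>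
  proof -
    have "V j \<omega> = W j \<omega>" if "j < m" for j
      using Qmono[of "Suc j" m \<omega>] that \<open>Q m \<omega> \<le> \<delta>\<close> by (auto simp: V_def)
    then show ?thesis by (simp add: S_def)
  qed
  have "prob {\<omega>\<in>space M. \<eta> < \<bar>\<Sum>j<m. W j \<omega> * (X (p (Suc j)) \<omega> - X (p j) \<omega>)\<bar>}
     \<le> prob ({\<omega>\<in>space M. \<delta> < Q m \<omega>} \<union> {\<omega>\<in>space M. \<eta>\<^sup>2 \<le> (S \<omega>)\<^sup>2})"
  proof (rule finite_measure_mono)
    show "{\<omega>\<in>space M. \<eta> < \<bar>\<Sum>j<m. W j \<omega> * (X (p (Suc j)) \<omega> - X (p j) \<omega>)\<bar>} \<subseteq>
       {\<omega>\<in>space M. \<delta> < Q m \<omega>} \<union> {\<omega>\<in>space M. \<eta>\<^sup>2 \<le> (S \<omega>)\<^sup>2}"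
    proof
      fix \<omega> assume \<omega>: "\<omega> \<in> {\<omega>\<in>space M. \<eta> < \<bar>\<Sum>j<m. W j \<omega> * (X (p (Suc j)) \<omega> - X (p j) \<omega>)\<bar>}"
      show "\<omega> \<in> {\<omega>\<in>space M. \<delta> < Q m \<omega>} \<union> {\<omega>\<in>space M. \<eta>\<^sup>2 \<le> (S \<omega>)\<^sup>2}"
      proof (cases "\<delta> < Q m \<omega>")
        case False
        then show ?thesis
          using \<omega> agree[of \<omega>] pos by (simp add: abs_le_square_iff[symmetric])
      qed (use \<omega> in simp)
    qed
  qed (use SM QM in measurable)
  also have "\<dots> \<le> prob {\<omega>\<in>space M. \<delta> < Q m \<omega>} + prob {\<omega>\<in>space M. \<eta>\<^sup>2 \<le> (S \<omega>)\<^sup>2}"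
    by (rule measure_Un_le) (use SM QM in measurable)
  also have "prob {\<omega>\<in>space M. \<eta>\<^sup>2 \<le> (S \<omega>)\<^sup>2} \<le> expectation (\<lambda>\<omega>. (S \<omega>)\<^sup>2) / \<eta>\<^sup>2"
    using integral_Markov_inequality_measure[OF S(2), of "{}" "\<eta>\<^sup>2"] pos by simp
  also have "\<dots> \<le> \<delta> / \<eta>\<^sup>2" using ES by (simp add: divide_right_mono)
  finally show ?thesis by (simp add: Q_def)
qed

end

lemma step_function_sq:
  fixes c p :: "nat \<Rightarrow> real"
  assumes "strict_mono_on {..m} p" "n \<le> m"
  shows "(\<Sum>j<n. c j * indicator {p j<..p (Suc j)} s)\<^sup>2 = (\<Sum>j<n. (c j)\<^sup>2 * indicator {p j<..p (Suc j)} s)"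
  using \<open>n \<le> m\<close>
proof (induction n)
  case (Suc n)
  have "c j * indicator {p j<..p (Suc j)} s * indicator {p n<..p (Suc n)} s = 0" if "j < n" for j
  proof -
    have "p (Suc j) \<le> p n"
      using strict_mono_on_less_eq[OF assms(1)] that Suc by auto
    then show ?thesis by (auto simp: indicator_def)
  qed
  then have "(\<Sum>j<n. c j * indicator {p j<..p (Suc j)} s) * indicator {p n<..p (Suc n)} s = 0"
    unfolding sum_distrib_right by (intro sum.neutral ballI) (simp only: lessThan_iff)
  then have "(\<Sum>j<n. c j * indicator {p j<..p (Suc j)} s) * (c n * indicator {p n<..p (Suc n)} s) = 0"
    by auto
  moreover have "(c n * indicator {p n<..p (Suc n)} s)\<^sup>2 = (c n)\<^sup>2 * indicator {p n<..p (Suc n)} s"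
    by (simp add: indicator_def)
  ultimately show ?case using Suc by (simp add: power2_sum)
qed simp

lemma nn_integral_step_function_sq:
  fixes c p :: "nat \<Rightarrow> real"
  assumes grid: "strict_mono_on {..m} p" "p ` {..m::nat} \<subseteq> {0..T}"
  shows "(\<integral>\<^sup>+s\<in>{0..T}. ennreal ((\<Sum>j<m. c j * indicator {p j<..p (Suc j)} s)\<^sup>2) \<partial>lborel)
     = ennreal (\<Sum>j<m. (c j)\<^sup>2 * (p (Suc j) - p j))"
proof -
  have p: "0 \<le> p n" "p n \<le> T" if "n \<le> m" for n
    using grid that by (auto simp: image_subset_iff)
  have less: "p j < p (Suc j)" if "j < m" for j
    using strict_mono_onD[OF grid(1), of j "Suc j"] that by simp
  have "(\<integral>\<^sup>+s\<in>{0..T}. ennreal ((\<Sum>j<m. c j * indicator {p j<..p (Suc j)} s)\<^sup>2) \<partial>lborel)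
     = (\<integral>\<^sup>+s. (\<Sum>j<m. ennreal ((c j)\<^sup>2) * indicator {p j<..p (Suc j)} s) \<partial>lborel)"
  proof (rule nn_integral_cong)
    fix s
    have "ennreal ((\<Sum>j<m. c j * indicator {p j<..p (Suc j)} s)\<^sup>2) * indicator {0..T} s
      = (\<Sum>j<m. ennreal ((c j)\<^sup>2 * indicator {p j<..p (Suc j)} s) * indicator {0..T} s)"
      unfolding step_function_sq[OF grid(1) order_refl] by (simp add: sum_distrib_right[symmetric])
    also have "\<dots> = (\<Sum>j<m. ennreal ((c j)\<^sup>2) * indicator {p j<..p (Suc j)} s)"
    proof (intro sum.cong refl)
      fix j assume "j \<in> {..<m}"
      then show "ennreal ((c j)\<^sup>2 * indicator {p j<..p (Suc j)} s) * indicator {0..T} s 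
        = ennreal ((c j)\<^sup>2) * indicator {p j<..p (Suc j)} s"
        using p(1)[of j] p(2)[of "Suc j"] by (auto simp: indicator_def)
    qed
    finally show "ennreal ((\<Sum>j<m. c j * indicator {p j<..p (Suc j)} s)\<^sup>2) * indicator {0..T} s
      = (\<Sum>j<m. ennreal ((c j)\<^sup>2) * indicator {p j<..p (Suc j)} s)" .
  qed
  also have "\<dots> = (\<Sum>j<m. ennreal ((c j)\<^sup>2) * ennreal (p (Suc j) - p j))"
    using less by (subst nn_integral_sum) (auto simp: nn_integral_cmult less_imp_le intro!: sum.cong)
  also have "\<dots> = ennreal (\<Sum>j<m. (c j)\<^sup>2 * (p (Suc j) - p j))"
    using less by (subst sum_ennreal[symmetric]) (auto simp: ennreal_mult less_imp_le intro!: sum.cong)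
  finally show ?thesis .
qed

context filtered_brownian
begin

text \<open>The index set is arbitrary and the intervals may overlap, so sums and differences of simple
  integrands with different partitions are covered at once.\<close>

lemma elementary_integral_tail_bound:
  fixes a b :: "'i \<Rightarrow> real"
  assumes "finite I"
    and ab: "\<And>i. i \<in> I \<Longrightarrow> 0 \<le> a i \<and> a i \<le> b i \<and> b i \<le> T"
    and Z: "\<And>i. i \<in> I \<Longrightarrow> Z i \<in> borel_measurable (F (a i))"
    and Zbound: "\<And>i. i \<in> I \<Longrightarrow> \<exists>B. \<forall>\<omega>\<in>space M. \<bar>Z i \<omega>\<bar> \<le> B"
    and pos: "\<delta> > 0" "\<eta> > 0"
  shows "prob {\<omega>\<in>space M. \<eta> < \<bar>\<Sum>i\<in>I. Z i \<omega> * (X (b i) \<omega> - X (a i) \<omega>)\<bar>}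
     \<le> prob {\<omega>\<in>space M. ennreal \<delta> <
          (\<integral>\<^sup>+s\<in>{0..T}. ennreal ((\<Sum>i\<in>I. Z i \<omega> * indicator {a i<..b i} s)\<^sup>2) \<partial>lborel)} + \<delta> / \<eta>\<^sup>2"
proof (cases "I = {}")
  case True
  then show ?thesis using pos by simp
next
  case False
  define P where "P = a ` I \<union> b ` I"
  have "finite P" "P \<noteq> {}" using \<open>finite I\<close> False by (auto simp: P_def)
  then obtain m p where grid: "strict_mono_on {..m} p" and P: "P = p ` {..m::nat}"
    by (rule finite_set_grid)
  have gT: "p ` {..m} \<subseteq> {0..T}" using ab unfolding P[symmetric] P_def by force
  have abP: "a i \<in> p ` {..m}" "b i \<in> p ` {..m}" "a i \<le> b i" if "i \<in> I" for i
    using that ab unfolding P[symmetric] P_def by auto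
  define W where "W = (\<lambda>j \<omega>. \<Sum>i\<in>I. if a i \<le> p j \<and> p (Suc j) \<le> b i then Z i \<omega> else 0)"
  have regroup: "(\<Sum>i\<in>I. Z i \<omega> * (f (b i) - f (a i))) = (\<Sum>j<m. W j \<omega> * (f (p (Suc j)) - f (p j)))" 
    for f :: "real \<Rightarrow> real" and \<omega>
  proof -
    have "(\<Sum>i\<in>I. Z i \<omega> * (f (b i) - f (a i))) 
      = (\<Sum>i\<in>I. \<Sum>j<m. Z i \<omega> * (if a i \<le> p j \<and> p (Suc j) \<le> b i then f (p (Suc j)) - f (p j) else 0))"
      by (intro sum.cong refl) (simp add: telescope_on_grid[OF grid abP] flip: sum_distrib_left)
    also have "\<dots> = (\<Sum>j<m. \<Sum>i\<in>I. Z i \<omega> * (if a i \<le> p j \<and> p (Suc j) \<le> b i then f (p (Suc j)) - f (p j) else 0))"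
      by (rule sum.swap)
    also have "\<dots> = (\<Sum>j<m. W j \<omega> * (f (p (Suc j)) - f (p j)))"
      unfolding W_def sum_distrib_right by (intro sum.cong refl) auto
    finally show ?thesis .
  qed
  have proc: "(\<Sum>i\<in>I. Z i \<omega> * indicator {a i<..b i} s) = (\<Sum>j<m. W j \<omega> * indicator {p j<..p (Suc j)} s)" for \<omega> s
  proof -
    have ind: "of_bool (s \<le> d) - of_bool (s \<le> c) = (indicator {c<..d} s :: real)" if "c \<le> d" for c d
      using that by (auto simp: indicator_def)
    have le: "p j \<le> p (Suc j)" if "j < m" for j
      using grid that by (auto simp: strict_mono_on_def less_imp_le)
    have "(\<Sum>i\<in>I. Z i \<omega> * indicator {a i<..b i} s) = (\<Sum>i\<in>I. Z i \<omega> * (of_bool (s \<le> b i) - of_bool (s \<le> a i)))"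
      by (intro sum.cong refl) (simp add: ind abP)
    also have "\<dots> = (\<Sum>j<m. W j \<omega> * (of_bool (s \<le> p (Suc j)) - of_bool (s \<le> p j)))"
      by (rule regroup)
    also have "\<dots> = (\<Sum>j<m. W j \<omega> * indicator {p j<..p (Suc j)} s)"
      by (intro sum.cong refl) (simp add: ind le)
    finally show ?thesis .
  qed
  have W: "W j \<in> borel_measurable (F (p j))" if "j < m" for j
    unfolding W_def
  proof (intro borel_measurable_sum)
    fix i assume "i \<in> I"
    have "p j \<in> {0..T}" using gT that by (auto simp: image_subset_iff)
    then show "(\<lambda>\<omega>. if a i \<le> p j \<and> p (Suc j) \<le> b i then Z i \<omega> else 0) \<in> borel_measurable (F (p j))"
      using measurable_mono[of "a i" "p j" "Z i"] Z[OF \<open>i \<in> I\<close>] ab[OF \<open>i \<in> I\<close>]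
      by (cases "a i \<le> p j \<and> p (Suc j) \<le> b i") auto
  qed
  obtain C where C: "\<And>i \<omega>. i \<in> I \<Longrightarrow> \<omega> \<in> space M \<Longrightarrow> \<bar>Z i \<omega>\<bar> \<le> C i"
    using Zbound by metis
  have B: "\<bar>W j \<omega>\<bar> \<le> (\<Sum>i\<in>I. \<bar>C i\<bar>)" if "j < m" "\<omega> \<in> space M" for j \<omega>
  proof -
    have "\<bar>W j \<omega>\<bar> \<le> (\<Sum>i\<in>I. \<bar>if a i \<le> p j \<and> p (Suc j) \<le> b i then Z i \<omega> else 0\<bar>)"
      unfolding W_def by (rule sum_abs)
    also have "\<dots> \<le> (\<Sum>i\<in>I. \<bar>C i\<bar>)"
    proof (intro sum_mono)
      fix i assume "i \<in> I"
      show "\<bar>if a i \<le> p j \<and> p (Suc j) \<le> b i then Z i \<omega> else 0\<bar> \<le> \<bar>C i\<bar>"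
        using C[OF \<open>i \<in> I\<close> that(2)] by (cases "a i \<le> p j \<and> p (Suc j) \<le> b i") auto
    qed
    finally show ?thesis .
  qed
  have "p j \<le> p (Suc j)" if "j < m" for j
    using grid that by (auto simp: strict_mono_on_def less_imp_le)
  then have "0 \<le> (\<Sum>j<m. (W j \<omega>)\<^sup>2 * (p (Suc j) - p j))" for \<omega>
    by (intro sum_nonneg) auto
  then have eq: "{\<omega>\<in>space M. ennreal \<delta> <
          (\<integral>\<^sup>+s\<in>{0..T}. ennreal ((\<Sum>i\<in>I. Z i \<omega> * indicator {a i<..b i} s)\<^sup>2) \<partial>lborel)}
     = {\<omega>\<in>space M. \<delta> < (\<Sum>j<m. (W j \<omega>)\<^sup>2 * (p (Suc j) - p j))}"
    unfolding proc nn_integral_step_function_sq[OF grid gT] using pos by (simp add: ennreal_less_iff)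
  show ?thesis
    unfolding eq regroup[of _ "\<lambda>t. X t _"] 
    by (rule grid_integral_tail_bound[OF grid gT W B pos])
qed

end

section \<open>Jointly measurable processes\<close>

lemma measurable_process_section:
  assumes "measurable_process M T Y" "\<omega> \<in> space M"
  shows "(\<lambda>t. Y t \<omega>) \<in> borel_measurable (restrict_space lborel {0..T})"
proof -
  have "(\<lambda>t. case (\<omega>, t) of (\<omega>, t) \<Rightarrow> Y t \<omega>) \<in> borel_measurable (restrict_space borel {0..T})"
    using assms unfolding measurable_process_def
    by (intro measurable_compose[OF measurable_Pair1'])
  moreover have "borel_measurable (restrict_space lborel {0..T}) = borel_measurable (restrict_space borel {0..T})"
    by (intro measurable_cong_sets sets_restrict_space_cong) simp_all
  ultimately show ?thesis by simp
qed

lemma measurable_process_lborel: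
  "measurable_process M T Y \<longleftrightarrow>
     (\<lambda>(\<omega>, t). Y t \<omega>) \<in> borel_measurable (M \<Otimes>\<^sub>M restrict_space lborel {0..T})"
proof -
  have "sets (restrict_space lborel {0..T}) = sets (restrict_space borel {0..T})"
    by (intro sets_restrict_space_cong) simp
  then have "sets (M \<Otimes>\<^sub>M restrict_space lborel {0..T}) = sets (M \<Otimes>\<^sub>M restrict_space borel {0..T})"
    by (intro sets_pair_measure_cong) simp_all
  from measurable_cong_sets[OF this refl, of "borel :: real measure"] show ?thesis
    unfolding measurable_process_def by simp
qed

lemma measurable_process_at:
  assumes "measurable_process M T Y" "t \<in> {0..T}"
  shows "Y t \<in> borel_measurable M"
proof -
  have "(\<lambda>\<omega>. case (\<omega>, t) of (\<omega>, t) \<Rightarrow> Y t \<omega>) \<in> borel_measurable M"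
    using assms unfolding measurable_process_def
    by (intro measurable_compose[OF measurable_Pair2']) (auto simp: space_restrict_space)
  then show ?thesis by simp
qed

lemma measurable_process_diff:
  assumes "measurable_process M T Y" "measurable_process M T Z"
  shows "measurable_process M T (\<lambda>t \<omega>. Y t \<omega> - Z t \<omega>)"
  using borel_measurable_diff[OF assms[unfolded measurable_process_def]]
  unfolding measurable_process_def by (simp add: case_prod_beta')

lemma measurable_process_elementary:
  assumes "\<And>i. i \<in> I \<Longrightarrow> Z i \<in> borel_measurable M"
  shows "measurable_process M T (\<lambda>s \<omega>. \<Sum>i\<in>I. Z i \<omega> * indicator {a i<..b i} s)"
  unfolding measurable_process_def case_prod_beta'
proof (intro borel_measurable_sum borel_measurable_times)
  fix i assume "i \<in> I"
  show "(\<lambda>x. Z i (fst x)) \<in> borel_measurable (M \<Otimes>\<^sub>M restrict_space borel {0..T})"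
    by (rule measurable_compose[OF measurable_fst assms[OF \<open>i \<in> I\<close>]])
  have "(indicator {a i<..b i} :: real \<Rightarrow> real) \<in> borel_measurable (restrict_space borel {0..T})"
    by (rule measurable_restrict_space1) simp
  from measurable_compose[OF measurable_snd[where ?M1.0=M] this]
  show "(\<lambda>x. indicator {a i<..b i} (snd x) :: real) \<in> borel_measurable (M \<Otimes>\<^sub>M restrict_space borel {0..T})" .
qed

lemma nn_integral_interval:
  "(\<integral>\<^sup>+s\<in>{0..T::real}. g s \<partial>lborel) = (\<integral>\<^sup>+s. g s \<partial>restrict_space lborel {0..T})"
  by (subst nn_integral_restrict_space) auto

lemma sigma_finite_interval: "sigma_finite_measure (restrict_space lborel {0..T::real})"
  by (intro sigma_finite_measure_restrict_space sigma_finite_lborel) simp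

lemma measurable_energy:
  assumes "measurable_process M T Y"
  shows "(\<lambda>\<omega>. \<integral>\<^sup>+s\<in>{0..T}. ennreal ((Y s \<omega>)\<^sup>2) \<partial>lborel) \<in> borel_measurable M"
proof -
  interpret sigma_finite_measure "restrict_space lborel {0..T}" by (rule sigma_finite_interval)
  have "(\<lambda>x. ennreal ((case x of (\<omega>, t) \<Rightarrow> Y t \<omega>)\<^sup>2)) \<in> borel_measurable (M \<Otimes>\<^sub>M restrict_space lborel {0..T})"
    using assms unfolding measurable_process_lborel by measurable
  from borel_measurable_nn_integral_fst[OF this] show ?thesis
    unfolding nn_integral_interval by simp
qed

section \<open>Stability of the Ito integral under deterministic steps\<close>

context filtered_brownian
begin

text \<open>Versions of the Ito integral are only determined as limits in probability, along sequences that may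
  differ for \<open>\<phi>\<close> and \<open>\<psi>\<close>. The difference of the two approximations minus the step is an elementary
  integrand whose energy tends to zero in probability, so by the tail bound its integral does too.
  The case \<open>c = 0\<close> is almost sure uniqueness of the integral.\<close>

lemma ito_integral_step_shift:
  assumes ito: "is_ito_integral M F T X \<phi> I" "is_ito_integral M F T X \<psi> J"
    and meas: "measurable_process M T \<phi>" "measurable_process M T \<psi>"
    and ab: "0 \<le> a" "a \<le> b" "b \<le> T"
    and shift: "AE \<omega> in M. AE s\<in>{0..T} in lborel. \<psi> s \<omega> = \<phi> s \<omega> + c * indicator {a<..b} s"
  shows "AE \<omega> in M. J \<omega> = I \<omega> + c * (X b \<omega> - X a \<omega>)"
proof -
  from ito(1) obtain n\<^sub>1 \<tau>\<^sub>1 Z\<^sub>1 where A1: "\<forall>n. simple_integrand F T (n\<^sub>1 n) (\<tau>\<^sub>1 n) (Z\<^sub>1 n)"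
    "\<forall>\<epsilon>>0. (\<lambda>n. prob {\<omega>\<in>space M. ennreal \<epsilon> <
            (\<integral>\<^sup>+s\<in>{0..T}. ennreal ((simple_process (n\<^sub>1 n) (\<tau>\<^sub>1 n) (Z\<^sub>1 n) s \<omega> - \<phi> s \<omega>)\<^sup>2) \<partial>lborel)}) \<longlonglongrightarrow> 0"
    "\<forall>\<epsilon>>0. (\<lambda>n. prob {\<omega>\<in>space M.
            \<epsilon> < \<bar>simple_integral X (n\<^sub>1 n) (\<tau>\<^sub>1 n) (Z\<^sub>1 n) \<omega> - I \<omega>\<bar>}) \<longlonglongrightarrow> 0"
    unfolding is_ito_integral_def by (elim conjE exE) (rule that)
  note s1 = A1(1)[rule_format] and e1 = A1(2)[rule_format] and i1 = A1(3)[rule_format]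
  from ito(2) obtain n\<^sub>2 \<tau>\<^sub>2 Z\<^sub>2 where A2: "\<forall>n. simple_integrand F T (n\<^sub>2 n) (\<tau>\<^sub>2 n) (Z\<^sub>2 n)"
    "\<forall>\<epsilon>>0. (\<lambda>n. prob {\<omega>\<in>space M. ennreal \<epsilon> <
            (\<integral>\<^sup>+s\<in>{0..T}. ennreal ((simple_process (n\<^sub>2 n) (\<tau>\<^sub>2 n) (Z\<^sub>2 n) s \<omega> - \<psi> s \<omega>)\<^sup>2) \<partial>lborel)}) \<longlonglongrightarrow> 0"
    "\<forall>\<epsilon>>0. (\<lambda>n. prob {\<omega>\<in>space M.
            \<epsilon> < \<bar>simple_integral X (n\<^sub>2 n) (\<tau>\<^sub>2 n) (Z\<^sub>2 n) \<omega> - J \<omega>\<bar>}) \<longlonglongrightarrow> 0"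
    unfolding is_ito_integral_def by (elim conjE exE) (rule that)
  note s2 = A2(1)[rule_format] and e2 = A2(2)[rule_format] and i2 = A2(3)[rule_format]
  have IJ[measurable]: "I \<in> borel_measurable M" "J \<in> borel_measurable M"
    using ito by (auto simp: is_ito_integral_def)
  have X[measurable]: "X a \<in> borel_measurable M" "X b \<in> borel_measurable M"
    using X_measurable ab by auto
  define \<Phi> where "\<Phi> n = simple_process (n\<^sub>1 n) (\<tau>\<^sub>1 n) (Z\<^sub>1 n)" for n
  define \<Psi> where "\<Psi> n = simple_process (n\<^sub>2 n) (\<tau>\<^sub>2 n) (Z\<^sub>2 n)" for n
  define I' where "I' n = simple_integral X (n\<^sub>1 n) (\<tau>\<^sub>1 n) (Z\<^sub>1 n)" for n
  define J' where "J' n = simple_integral X (n\<^sub>2 n) (\<tau>\<^sub>2 n) (Z\<^sub>2 n)" for n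
  have simple_meas: "measurable_process M T (simple_process k \<tau> Z)" "simple_integral X k \<tau> Z \<in> borel_measurable M"
    if "simple_integrand F T k \<tau> Z" for k \<tau> Z
  proof -
    have *: "0 \<le> \<tau> i" "\<tau> i \<le> T" "0 \<le> \<tau> (Suc i)" "\<tau> (Suc i) \<le> T" "Z i \<in> borel_measurable M" if "i < k" for i
    proof -
      show p: "0 \<le> \<tau> i" "\<tau> i \<le> T" "0 \<le> \<tau> (Suc i)" "\<tau> (Suc i) \<le> T" 
        using \<open>simple_integrand F T k \<tau> Z\<close> that by (force simp: simple_integrand_def)+
      show "Z i \<in> borel_measurable M"
        by (rule measurable_from_filtration[OF p(1,2)]) 
          (use \<open>simple_integrand F T k \<tau> Z\<close> that in \<open>simp add: simple_integrand_def\<close>)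
    qed
    have "simple_process k \<tau> Z = (\<lambda>s \<omega>. \<Sum>i<k. Z i \<omega> * indicator {\<tau> i<..\<tau> (Suc i)} s)"
      by (simp add: simple_process_def fun_eq_iff)
    then show "measurable_process M T (simple_process k \<tau> Z)"
      using measurable_process_elementary[of "{..<k}" Z M T \<tau> "\<lambda>i. \<tau> (Suc i)"] * by simp
    have "simple_integral X k \<tau> Z = (\<lambda>\<omega>. \<Sum>i<k. Z i \<omega> * (X (\<tau> (Suc i)) \<omega> - X (\<tau> i) \<omega>))"
      by (simp add: simple_integral_def fun_eq_iff)
    then show "simple_integral X k \<tau> Z \<in> borel_measurable M"
      using * X_measurable 
      by (simp add: borel_measurable_sum borel_measurable_times borel_measurable_diff)
  qed
  have [measurable]: "I' n \<in> borel_measurable M" "J' n \<in> borel_measurable M" for n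
    unfolding I'_def J'_def using simple_meas(2) s1 s2 by auto
  define E1 where "E1 n \<omega> = (\<integral>\<^sup>+s\<in>{0..T}. ennreal ((\<Phi> n s \<omega> - \<phi> s \<omega>)\<^sup>2) \<partial>lborel)" for n \<omega>
  define E2 where "E2 n \<omega> = (\<integral>\<^sup>+s\<in>{0..T}. ennreal ((\<Psi> n s \<omega> - \<psi> s \<omega>)\<^sup>2) \<partial>lborel)" for n \<omega>
  define E where "E n \<omega> = (\<integral>\<^sup>+s\<in>{0..T}. ennreal ((\<Psi> n s \<omega> - \<Phi> n s \<omega> - c * indicator {a<..b} s)\<^sup>2) \<partial>lborel)" for n \<omega>
  have mp: "measurable_process M T (\<lambda>s \<omega>. \<Phi> n s \<omega> - \<phi> s \<omega>)" "measurable_process M T (\<lambda>s \<omega>. \<Psi> n s \<omega> - \<psi> s \<omega>)" for n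
    unfolding \<Phi>_def \<Psi>_def using simple_meas(1) s1 s2 meas by (auto intro!: measurable_process_diff)
  have [measurable]: "E1 n \<in> borel_measurable M" "E2 n \<in> borel_measurable M" for n
    unfolding E1_def E2_def by (rule measurable_energy[OF mp(1)] measurable_energy[OF mp(2)])+
  have tail: "prob {\<omega>\<in>space M. \<eta> < \<bar>J' n \<omega> - I' n \<omega> - c * (X b \<omega> - X a \<omega>)\<bar>}
      \<le> prob {\<omega>\<in>space M. ennreal \<delta> < E n \<omega>} + \<delta> / \<eta>\<^sup>2" if pos: "\<delta> > 0" "\<eta> > 0" for n \<delta> \<eta>
  proof -
    \<comment> \<open>The difference is indexed by the cells of \<open>\<Psi> n\<close>, those of \<open>\<Phi> n\<close>, and one index for the step.\<close>
    define K where "K = ({..<n\<^sub>2 n} <+> ({..<n\<^sub>1 n} <+> {()}))"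
    define \<alpha> where "\<alpha> = case_sum (\<tau>\<^sub>2 n) (case_sum (\<tau>\<^sub>1 n) (\<lambda>_::unit. a))"
    define \<beta> where "\<beta> = case_sum (\<lambda>i. \<tau>\<^sub>2 n (Suc i)) (case_sum (\<lambda>i. \<tau>\<^sub>1 n (Suc i)) (\<lambda>_::unit. b))"
    define \<zeta> where "\<zeta> = case_sum (Z\<^sub>2 n) (case_sum (\<lambda>i \<omega>. - Z\<^sub>1 n i \<omega>) (\<lambda>(_::unit) \<omega>. - c))"
    have fin: "finite K" by (simp add: K_def)
    have sumK: "(\<Sum>k\<in>K. g k) = (\<Sum>i<n\<^sub>2 n. g (Inl i)) + ((\<Sum>i<n\<^sub>1 n. g (Inr (Inl i))) + g (Inr (Inr ())))" 
      for g :: "_ \<Rightarrow> real"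
      unfolding K_def by (simp add: sum.Plus)
    have 1: "0 \<le> \<alpha> k \<and> \<alpha> k \<le> \<beta> k \<and> \<beta> k \<le> T" if "k \<in> K" for k
      using that s1[of n] s2[of n] ab unfolding K_def \<alpha>_def \<beta>_def
      by (auto simp: simple_integrand_def)
    have 2: "\<zeta> k \<in> borel_measurable (F (\<alpha> k))" if "k \<in> K" for k
      using that s1[of n] s2[of n] unfolding K_def \<alpha>_def \<zeta>_def
      by (auto simp: simple_integrand_def)
    have 3: "\<exists>B. \<forall>\<omega>\<in>space M. \<bar>\<zeta> k \<omega>\<bar> \<le> B" if "k \<in> K" for k
    proof -
      have "0 \<le> \<alpha> k" "\<alpha> k \<le> T" using 1[OF that] by auto
      then have "space M = space (F (\<alpha> k))" using space_filtration by auto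
      moreover have "\<exists>B. \<forall>\<omega>\<in>space (F (\<alpha> k)). \<bar>\<zeta> k \<omega>\<bar> \<le> B"
        using that s1[of n] s2[of n] unfolding K_def \<alpha>_def \<zeta>_def
        by (auto simp: simple_integrand_def)
      ultimately show ?thesis by simp
    qed
    have 4: "(\<Sum>k\<in>K. \<zeta> k \<omega> * (X (\<beta> k) \<omega> - X (\<alpha> k) \<omega>)) = J' n \<omega> - I' n \<omega> - c * (X b \<omega> - X a \<omega>)" for \<omega>
      unfolding sumK \<alpha>_def \<beta>_def \<zeta>_def I'_def J'_def simple_integral_def
      by (simp add: sum_negf sum_subtractf algebra_simps)
    have 5: "(\<Sum>k\<in>K. \<zeta> k \<omega> * indicator {\<alpha> k<..\<beta> k} s) = \<Psi> n s \<omega> - \<Phi> n s \<omega> - c * indicator {a<..b} s" for \<omega> s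
      unfolding sumK \<alpha>_def \<beta>_def \<zeta>_def \<Phi>_def \<Psi>_def simple_process_def
      by (simp add: sum_negf sum_subtractf algebra_simps)
    show ?thesis
      using elementary_integral_tail_bound[of K \<alpha> \<beta> \<zeta>, OF fin 1 2 3 pos]
      unfolding 4 5 E_def[symmetric] .
  qed
  \<comment> \<open>Hence \<open>E n > \<delta>\<close> forces one of the two approximation errors above \<open>\<delta> / 4\<close>.\<close>
  have E_le: "AE \<omega> in M. E n \<omega> \<le> 2 * E1 n \<omega> + 2 * E2 n \<omega>" for n
    using shift AE_space
  proof eventually_elim
    case (elim \<omega>)
    have m: "(\<lambda>s. \<Phi> n s \<omega> - \<phi> s \<omega>) \<in> borel_measurable (restrict_space lborel {0..T})" 
        "(\<lambda>s. \<Psi> n s \<omega> - \<psi> s \<omega>) \<in> borel_measurable (restrict_space lborel {0..T})"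
      using measurable_process_section[OF mp(1) elim(2)] measurable_process_section[OF mp(2) elim(2)] by auto
    have "E n \<omega> \<le> (\<integral>\<^sup>+s. 2 * ennreal ((\<Phi> n s \<omega> - \<phi> s \<omega>)\<^sup>2) + 2 * ennreal ((\<Psi> n s \<omega> - \<psi> s \<omega>)\<^sup>2) 
        \<partial>restrict_space lborel {0..T})"
      unfolding E_def nn_integral_interval
    proof (rule nn_integral_mono_AE)
      have "AE s in restrict_space lborel {0..T}. \<psi> s \<omega> = \<phi> s \<omega> + c * indicator {a<..b} s"
        using elim(1) by (subst AE_restrict_space_iff) auto
      then show "AE s in restrict_space lborel {0..T}.
        ennreal ((\<Psi> n s \<omega> - \<Phi> n s \<omega> - c * indicator {a<..b} s)\<^sup>2) 
        \<le> 2 * ennreal ((\<Phi> n s \<omega> - \<phi> s \<omega>)\<^sup>2) + 2 * ennreal ((\<Psi> n s \<omega> - \<psi> s \<omega>)\<^sup>2)"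
      proof eventually_elim
        case (elim s)
        have ineq: "(y - x)\<^sup>2 \<le> 2 * x\<^sup>2 + 2 * y\<^sup>2" for x y :: real
          using zero_le_power2[of "x + y"] by (simp add: power2_eq_square algebra_simps)
        have "(\<Psi> n s \<omega> - \<Phi> n s \<omega> - c * indicator {a<..b} s)\<^sup>2 = ((\<Psi> n s \<omega> - \<psi> s \<omega>) - (\<Phi> n s \<omega> - \<phi> s \<omega>))\<^sup>2"
          unfolding elim by (simp add: algebra_simps)
        also have "\<dots> \<le> 2 * (\<Phi> n s \<omega> - \<phi> s \<omega>)\<^sup>2 + 2 * (\<Psi> n s \<omega> - \<psi> s \<omega>)\<^sup>2"
          by (rule ineq)
        finally have "ennreal ((\<Psi> n s \<omega> - \<Phi> n s \<omega> - c * indicator {a<..b} s)\<^sup>2) \<le>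
          ennreal (2 * (\<Phi> n s \<omega> - \<phi> s \<omega>)\<^sup>2 + 2 * (\<Psi> n s \<omega> - \<psi> s \<omega>)\<^sup>2)" by (rule ennreal_leI)
        then show ?case by (simp add: ennreal_mult' ennreal_plus)
      qed
    qed
    also have "\<dots> = 2 * E1 n \<omega> + 2 * E2 n \<omega>"
      unfolding E1_def E2_def nn_integral_interval using m
      by (subst nn_integral_add) (auto simp: nn_integral_cmult)
    finally show ?case .
  qed
  define D where "D \<omega> = \<bar>J \<omega> - I \<omega> - c * (X b \<omega> - X a \<omega>)\<bar>" for \<omega>
  have [measurable]: "D \<in> borel_measurable M" unfolding D_def by measurable
  have key: "prob {\<omega>\<in>space M. 3 * \<eta> < D \<omega>} \<le> \<delta> / \<eta>\<^sup>2" if pos: "\<delta> > 0" "\<eta> > 0" for \<delta> \<eta>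
  proof (rule LIMSEQ_le_const)
    let ?b = "\<lambda>n. prob {\<omega>\<in>space M. \<eta> < \<bar>I' n \<omega> - I \<omega>\<bar>} + prob {\<omega>\<in>space M. \<eta> < \<bar>J' n \<omega> - J \<omega>\<bar>} +
      (prob {\<omega>\<in>space M. ennreal (\<delta> / 4) < E1 n \<omega>} + prob {\<omega>\<in>space M. ennreal (\<delta> / 4) < E2 n \<omega>}) + \<delta> / \<eta>\<^sup>2"
    have "?b \<longlonglongrightarrow> 0 + 0 + (0 + 0) + \<delta> / \<eta>\<^sup>2"
      unfolding I'_def J'_def E1_def E2_def \<Phi>_def \<Psi>_def
      by (intro tendsto_add i1 i2 e1 e2 tendsto_const) (use pos in auto)
    then show "?b \<longlonglongrightarrow> \<delta> / \<eta>\<^sup>2" by simp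
    have "prob {\<omega>\<in>space M. 3 * \<eta> < D \<omega>} \<le> ?b n" for n
    proof -
      have split: "{\<omega>\<in>space M. 3 * \<eta> < D \<omega>} \<subseteq> ({\<omega>\<in>space M. \<eta> < \<bar>I' n \<omega> - I \<omega>\<bar>} \<union> {\<omega>\<in>space M. \<eta> < \<bar>J' n \<omega> - J \<omega>\<bar>})
         \<union> {\<omega>\<in>space M. \<eta> < \<bar>J' n \<omega> - I' n \<omega> - c * (X b \<omega> - X a \<omega>)\<bar>}"
        unfolding D_def using pos by (auto simp: not_less abs_le_iff)
      have "prob {\<omega>\<in>space M. 3 * \<eta> < D \<omega>} \<le> prob (({\<omega>\<in>space M. \<eta> < \<bar>I' n \<omega> - I \<omega>\<bar>} \<union> {\<omega>\<in>space M. \<eta> < \<bar>J' n \<omega> - J \<omega>\<bar>})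
         \<union> {\<omega>\<in>space M. \<eta> < \<bar>J' n \<omega> - I' n \<omega> - c * (X b \<omega> - X a \<omega>)\<bar>})"
        by (rule finite_measure_mono[OF split]) measurable
      also have "\<dots> \<le> prob ({\<omega>\<in>space M. \<eta> < \<bar>I' n \<omega> - I \<omega>\<bar>} \<union> {\<omega>\<in>space M. \<eta> < \<bar>J' n \<omega> - J \<omega>\<bar>})
         + prob {\<omega>\<in>space M. \<eta> < \<bar>J' n \<omega> - I' n \<omega> - c * (X b \<omega> - X a \<omega>)\<bar>}"
        by (rule measure_Un_le) measurable
      also have "prob ({\<omega>\<in>space M. \<eta> < \<bar>I' n \<omega> - I \<omega>\<bar>} \<union> {\<omega>\<in>space M. \<eta> < \<bar>J' n \<omega> - J \<omega>\<bar>})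
         \<le> prob {\<omega>\<in>space M. \<eta> < \<bar>I' n \<omega> - I \<omega>\<bar>} + prob {\<omega>\<in>space M. \<eta> < \<bar>J' n \<omega> - J \<omega>\<bar>}"
        by (rule measure_Un_le) measurable
      also have "prob {\<omega>\<in>space M. \<eta> < \<bar>J' n \<omega> - I' n \<omega> - c * (X b \<omega> - X a \<omega>)\<bar>}
         \<le> prob {\<omega>\<in>space M. ennreal \<delta> < E n \<omega>} + \<delta> / \<eta>\<^sup>2"
        by (rule tail[OF pos])
      also have "prob {\<omega>\<in>space M. ennreal \<delta> < E n \<omega>} 
         \<le> prob ({\<omega>\<in>space M. ennreal (\<delta> / 4) < E1 n \<omega>} \<union> {\<omega>\<in>space M. ennreal (\<delta> / 4) < E2 n \<omega>})"
      proof (rule finite_measure_mono_AE)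
        show "AE \<omega> in M. \<omega> \<in> {\<omega>\<in>space M. ennreal \<delta> < E n \<omega>} \<longrightarrow>
           \<omega> \<in> {\<omega>\<in>space M. ennreal (\<delta> / 4) < E1 n \<omega>} \<union> {\<omega>\<in>space M. ennreal (\<delta> / 4) < E2 n \<omega>}"
          using E_le[of n]
        proof eventually_elim
          case (elim \<omega>)
          have "E n \<omega> \<le> ennreal \<delta>" if le: "E1 n \<omega> \<le> ennreal (\<delta> / 4)" "E2 n \<omega> \<le> ennreal (\<delta> / 4)"
          proof -
            have "E n \<omega> \<le> 2 * ennreal (\<delta> / 4) + 2 * ennreal (\<delta> / 4)"
              using elim le by (meson add_mono mult_left_mono order_trans zero_le)
            also have "\<dots> = ennreal (2 * (\<delta> / 4) + 2 * (\<delta> / 4))"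
              using pos by (simp only: ennreal_mult' ennreal_plus ennreal_numeral zero_le_numeral)
            also have "\<dots> = ennreal \<delta>" by simp
            finally show ?thesis .
          qed
          then show ?case using not_le by blast
        qed
      qed measurable
      also have "\<dots> \<le> prob {\<omega>\<in>space M. ennreal (\<delta> / 4) < E1 n \<omega>} + prob {\<omega>\<in>space M. ennreal (\<delta> / 4) < E2 n \<omega>}"
        by (rule measure_Un_le) measurable
      finally show ?thesis by simp
    qed
    then show "\<exists>N. \<forall>n\<ge>N. prob {\<omega>\<in>space M. 3 * \<eta> < D \<omega>} \<le> ?b n" by blast
  qed
  have null: "prob {\<omega>\<in>space M. \<eta> < D \<omega>} = 0" if "\<eta> > 0" for \<eta>
  proof -
    have "prob {\<omega>\<in>space M. \<eta> < D \<omega>} \<le> 0 + e" if "e > 0" for e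
      using key[of "e * (\<eta> / 3)\<^sup>2" "\<eta> / 3"] \<open>\<eta> > 0\<close> that by simp
    then have "prob {\<omega>\<in>space M. \<eta> < D \<omega>} \<le> 0" by (rule field_le_epsilon)
    then show ?thesis using measure_nonneg[of M] by (simp add: antisym)
  qed
  have "AE \<omega> in M. \<not> 1 / real (Suc n) < D \<omega>" for n
  proof -
    have "emeasure M {\<omega>\<in>space M. 1 / real (Suc n) < D \<omega>} = 0"
      using null[of "1 / real (Suc n)"] by (simp add: emeasure_eq_measure)
    then show ?thesis by (subst AE_iff_measurable) auto
  qed
  then have "AE \<omega> in M. \<forall>n. \<not> 1 / real (Suc n) < D \<omega>" by (simp add: AE_all_countable)
  then show ?thesis
  proof eventually_elim
    case (elim \<omega>)
    have "\<not> 0 < D \<omega>"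
      using elim reals_Archimedean[of "D \<omega>"] by (auto simp: inverse_eq_divide)
    then show ?case by (simp add: D_def)
  qed
qed

end

section \<open>Girsanov densities of shifted drifts\<close>

text \<open>The positive and negative parts of \<open>f - g\<close> on \<open>[0,T]\<close> are densities of finite measures with the same
  distribution function, so these measures and hence their densities agree.\<close>

lemma AE_eq_if_indefinite_integral_eq:
  fixes f g :: "real \<Rightarrow> real"
  assumes f: "set_integrable lborel {0..T} f" and g: "set_integrable lborel {0..T} g"
    and eq: "\<And>t. t \<in> {0..T} \<Longrightarrow> (LINT s:{0..t}|lborel. f s) = (LINT s:{0..t}|lborel. g s)"
  shows "AE s\<in>{0..T} in lborel. f s = g s"
proof -
  define h where "h s = indicator {0..T} s * (f s - g s)" for s
  have h: "integrable lborel h"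
    using set_integral_diff(1)[OF f g] unfolding set_integrable_def h_def by simp
  have zero: "(LINT s:{..x}|lborel. h s) = 0" for x
  proof (cases "x < 0 \<or> T < 0")
    case True
    then have "(\<lambda>s. indicator {..x} s *\<^sub>R h s) = (\<lambda>s. 0)" by (auto simp: h_def indicator_def)
    then show ?thesis by (simp add: set_lebesgue_integral_def)
  next
    case False
    then have t: "min x T \<in> {0..T}" by auto
    have sub: "set_integrable lborel {0..min x T} f" "set_integrable lborel {0..min x T} g"
      by (rule set_integrable_subset[OF f] set_integrable_subset[OF g]; auto)+
    have "(LINT s:{..x}|lborel. h s) = (LINT s:{0..min x T}|lborel. f s - g s)"
      unfolding set_lebesgue_integral_def h_def by (intro Bochner_Integration.integral_cong) (auto simp: indicator_def)
    also have "\<dots> = 0" using set_integral_diff(2)[OF sub] eq[OF t] by simp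
    finally show ?thesis .
  qed
  define P where "P = (\<lambda>s. max 0 (h s))" 
  define N where "N = (\<lambda>s. max 0 (- h s))"
  have PN: "integrable lborel P" "integrable lborel N" "\<And>s. 0 \<le> P s" "\<And>s. 0 \<le> N s"
    using h by (auto simp: P_def N_def)
  have [measurable]: "P \<in> borel_measurable borel" "N \<in> borel_measurable borel" using PN by auto
  have em: "emeasure (density lborel (\<lambda>s. ennreal (Q s))) A = ennreal (LINT s:A|lborel. Q s)"
    if Q: "integrable lborel Q" "\<And>s. 0 \<le> Q s" and A: "A \<in> sets borel" for Q :: "real \<Rightarrow> real" and A
  proof -
    have "emeasure (density lborel (\<lambda>s. ennreal (Q s))) A = (\<integral>\<^sup>+s. ennreal (indicator A s * Q s) \<partial>lborel)"
      using Q A by (subst emeasure_density) (auto simp: indicator_def intro!: nn_integral_cong)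
    also have "\<dots> = ennreal (LINT s:A|lborel. Q s)"
      unfolding set_lebesgue_integral_def using integrable_mult_indicator[of A lborel Q] Q A
      by (subst nn_integral_eq_integral) auto
    finally show ?thesis .
  qed
  have fin: "finite_borel_measure (density lborel (\<lambda>s. ennreal (Q s)))"
    if Q: "integrable lborel Q" "\<And>s. 0 \<le> Q s" for Q :: "real \<Rightarrow> real"
  proof -
    have "finite_measure (density lborel (\<lambda>s. ennreal (Q s)))"
      by (rule finite_measureI) (simp add: em[OF Q])
    then show ?thesis
      by (simp add: finite_borel_measure_def finite_borel_measure_axioms_def)
  qed
  have "(LINT s:{..x}|lborel. P s) = (LINT s:{..x}|lborel. N s)" for x
  proof -
    have i: "set_integrable lborel {..x} P" "set_integrable lborel {..x} N"
      unfolding set_integrable_def by (intro integrable_mult_indicator PN; simp)+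
    have "(LINT s:{..x}|lborel. P s - N s) = (LINT s:{..x}|lborel. h s)"
      by (intro set_lebesgue_integral_cong) (auto simp: P_def N_def)
    then show ?thesis using set_integral_diff(2)[OF i] zero by simp
  qed
  then have "cdf (density lborel (\<lambda>s. ennreal (P s))) = cdf (density lborel (\<lambda>s. ennreal (N s)))"
    unfolding cdf_def measure_def by (simp add: em PN fun_eq_iff)
  then have "density lborel (\<lambda>s. ennreal (P s)) = density lborel (\<lambda>s. ennreal (N s))"
    using cdf_unique'[OF fin[OF PN(1,3)] fin[OF PN(2,4)]] by blast
  moreover have "(\<integral>\<^sup>+s. ennreal (P s) \<partial>lborel) \<noteq> \<infinity>"
    using PN by (simp add: nn_integral_eq_integral)
  ultimately have "AE s in lborel. ennreal (P s) = ennreal (N s)"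
    by (subst (asm) finite_density_unique) auto
  then show ?thesis
    by eventually_elim (auto simp: P_def N_def h_def max_def split: if_splits)
qed

lemma square_integrable_on_interval:
  fixes f :: "real \<Rightarrow> real"
  assumes m: "f \<in> borel_measurable (restrict_space lborel {0..T})"
    and fin: "(\<integral>\<^sup>+s\<in>{0..T}. ennreal ((f s)\<^sup>2) \<partial>lborel) < \<infinity>"
  shows "set_integrable lborel {0..T} (\<lambda>s. (f s)\<^sup>2)" "set_integrable lborel {0..T} f"
proof -
  let ?N = "restrict_space lborel {0..T}"
  have iff: "set_integrable lborel {0..T} h \<longleftrightarrow> integrable ?N h" for h :: "real \<Rightarrow> real"
    unfolding set_integrable_def by (subst integrable_restrict_space) auto
  have sq: "integrable ?N (\<lambda>s. (f s)\<^sup>2)"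
    using m fin unfolding nn_integral_interval by (intro integrableI_bounded) auto
  have "integrable ?N (\<lambda>s. 1 :: real)"
    unfolding iff[symmetric] set_integrable_def
    using integrable_real_indicator[of "{0..T}" lborel] by (simp add: emeasure_lborel_Icc_eq)
  then have one: "integrable ?N (\<lambda>s. 1 + (f s)\<^sup>2)" using sq by (rule Bochner_Integration.integrable_add)
  have "norm (f s) \<le> norm (1 + (f s)\<^sup>2)" for s
    using zero_le_power2[of "\<bar>f s\<bar> - 1"] zero_le_power2[of "f s"] by (auto simp: power2_eq_square algebra_simps abs_if)
  then have "integrable ?N f" by (intro Bochner_Integration.integrable_bound[OF one m] AE_I2)
  then show "set_integrable lborel {0..T} f" "set_integrable lborel {0..T} (\<lambda>s. (f s)\<^sup>2)"
    using sq unfolding iff by auto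
qed

lemma interval_step_integral:
  fixes a b t :: real
  assumes "0 \<le> a" "a \<le> b" "0 \<le> t"
  shows "set_integrable lborel {0..t} (\<lambda>s. c * indicator {a<..b} s)"
    "(LINT s:{0..t}|lborel. c * indicator {a<..b} s) = c * (min t b - min t a)"
proof -
  have e: "(\<lambda>s. indicator {0..t} s *\<^sub>R (c * indicator {a<..b} s)) = (\<lambda>s. c * indicator {min t a<..min t b} s)"
    using assms by (auto simp: indicator_def fun_eq_iff)
  show "set_integrable lborel {0..t} (\<lambda>s. c * indicator {a<..b} s)"
    unfolding set_integrable_def e 
    by (intro integrable_mult_right integrable_real_indicator) 
      (use min.mono[OF order_refl \<open>a \<le> b\<close>, of t] in simp_all)
  show "(LINT s:{0..t}|lborel. c * indicator {a<..b} s) = c * (min t b - min t a)"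
    unfolding set_lebesgue_integral_def e using assms by simp
qed

text \<open>On \<open>[0,T]\<close> this function vanishes up to \<open>a\<close>, rises with slope \<open>c\<close> on \<open>[a,b]\<close>, and is constant afterwards. It is
  the perturbation that isolates the increment over \<open>[a,b]\<close>.\<close>

lemma ramp_in_H10:
  assumes "0 \<le> a" "a \<le> b" "b \<le> T"
  shows "(\<lambda>t. c * (min t b - min t a)) \<in> H10 T"
proof -
  have sq: "(c * indicator {a<..b} s)\<^sup>2 = c\<^sup>2 * indicator {a<..b} s" for s :: real
    by (simp add: indicator_def)
  have "(\<lambda>s. c * indicator {a<..b} s) \<in> borel_measurable borel" by measurable
  moreover have "set_integrable lborel {0..T} (\<lambda>s. (c * indicator {a<..b} s)\<^sup>2)"
    unfolding sq using interval_step_integral(1)[of a b T "c\<^sup>2"] assms by simp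
  moreover have "\<forall>t\<in>{0..T}. c * (min t b - min t a) = (LINT s:{0..t}|lborel. c * indicator {a<..b} s)"
    by (intro ballI interval_step_integral(2)[symmetric]) (use assms in auto)
  ultimately show ?thesis unfolding H10_def by blast
qed

context filtered_brownian
begin

text \<open>The properties of the chosen derivative and of the chosen stochastic integral on which the Girsanov
  density depends.\<close>

lemma drift_derivative_properties:
  assumes "girsanov_drift M F T X u"
  defines "v \<equiv> drift_derivative M F T u"
  shows "measurable_process M T v"
    and "AE \<omega> in M. set_integrable lborel {0..T} (\<lambda>s. v s \<omega>) \<and> set_integrable lborel {0..T} (\<lambda>s. (v s \<omega>)\<^sup>2) \<and>
        (\<forall>t\<in>{0..T}. u t \<omega> = (LINT s:{0..t}|lborel. v s \<omega>))"
    and "is_ito_integral M F T X v (ito_integral M F T X v)"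
proof -
  have "\<exists>v. is_drift_derivative M F T u v" "ito_integrable M F T X v"
    using assms(1) by (simp_all add: girsanov_drift_def v_def)
  then have ito: "\<exists>I. is_ito_integral M F T X v I" and ex: "\<exists>v. is_drift_derivative M F T u v"
    by (simp_all add: ito_integrable_def)
  from someI_ex[OF ex] have d: "is_drift_derivative M F T u v"
    unfolding v_def drift_derivative_def .
  show m: "measurable_process M T v" using d by (simp add: is_drift_derivative_def)
  have "AE \<omega> in M. (\<integral>\<^sup>+s\<in>{0..T}. ennreal ((v s \<omega>)\<^sup>2) \<partial>lborel) < \<infinity>"
    "AE \<omega> in M. \<forall>t\<in>{0..T}. u t \<omega> = (LINT s:{0..t}|lborel. v s \<omega>)"
    using d by (auto simp: is_drift_derivative_def)
  then show "AE \<omega> in M. set_integrable lborel {0..T} (\<lambda>s. v s \<omega>) \<and> set_integrable lborel {0..T} (\<lambda>s. (v s \<omega>)\<^sup>2) \<and>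
        (\<forall>t\<in>{0..T}. u t \<omega> = (LINT s:{0..t}|lborel. v s \<omega>))"
    using AE_space
  proof eventually_elim
    case (elim \<omega>)
    from square_integrable_on_interval[OF measurable_process_section[OF m elim(3)] elim(1)] elim(2)
    show ?case by (intro conjI)
  qed
  show "is_ito_integral M F T X v (ito_integral M F T X v)"
    unfolding ito_integral_def by (rule someI_ex[OF ito])
qed

lemma girsanov_density_measurable:
  assumes "girsanov_drift M F T X u"
  shows "girsanov_density M F T X u \<in> borel_measurable M"
proof -
  define v where "v = drift_derivative M F T u"
  note v = drift_derivative_properties[OF assms, folded v_def]
  interpret N: sigma_finite_measure "restrict_space lborel {0..T}" by (rule sigma_finite_interval)
  have I[measurable]: "ito_integral M F T X v \<in> borel_measurable M"
    using v(3) by (simp add: is_ito_integral_def)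
  have eq: "(LINT s:{0..T}|lborel. (v s \<omega>)\<^sup>2) = (LINT s|restrict_space lborel {0..T}. (v s \<omega>)\<^sup>2)" for \<omega>
    unfolding set_lebesgue_integral_def by (subst integral_restrict_space) auto
  have "(\<lambda>(\<omega>, s). (v s \<omega>)\<^sup>2) \<in> borel_measurable (M \<Otimes>\<^sub>M restrict_space lborel {0..T})"
    using borel_measurable_power[OF v(1)[unfolded measurable_process_lborel], of 2]
    by (simp add: case_prod_beta')
  then have [measurable]: "(\<lambda>\<omega>. LINT s|restrict_space lborel {0..T}. (v s \<omega>)\<^sup>2) \<in> borel_measurable M"
    by (rule N.borel_measurable_lebesgue_integral)
  show ?thesis
    unfolding girsanov_density_def v_def[symmetric] eq by measurable
qed

text \<open>The derivative of \<open>w\<close> is that of \<open>u\<close> plus \<open>\<epsilon> 1\<^bsub>(a,b]\<^esub>\<close> for almost every path and time. This adds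
  \<open>\<epsilon> (X\<^sub>b - X\<^sub>a)\<close> to the stochastic integral and \<open>2 \<epsilon> (u\<^sub>b - u\<^sub>a) + \<epsilon>\<^sup>2 (b - a)\<close> to the energy.\<close>

lemma girsanov_density_ramp_shift:
  assumes u: "girsanov_drift M F T X u" and w: "girsanov_drift M F T X w"
    and ab: "0 \<le> a" "a \<le> b" "b \<le> T"
    and shift: "\<And>t \<omega>. t \<in> {0..T} \<Longrightarrow> \<omega> \<in> space M \<Longrightarrow> w t \<omega> = u t \<omega> + \<epsilon> * (min t b - min t a)"
  shows "AE \<omega> in M. girsanov_density M F T X w \<omega> = girsanov_density M F T X u \<omega> *
    exp (\<epsilon> * ((X b \<omega> - u b \<omega>) - (X a \<omega> - u a \<omega>)) - \<epsilon>\<^sup>2 * (b - a) / 2)"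
proof -
  define v where "v = drift_derivative M F T u"
  define v' where "v' = drift_derivative M F T w"
  note v = drift_derivative_properties[OF u, folded v_def]
  note v' = drift_derivative_properties[OF w, folded v'_def]
  have step: "set_integrable lborel {0..t} (\<lambda>s. \<epsilon> * indicator {a<..b} s)"
     "(LINT s:{0..t}|lborel. \<epsilon> * indicator {a<..b} s) = \<epsilon> * (min t b - min t a)" if "0 \<le> t" for t
    using interval_step_integral[OF ab(1,2) that] by auto
  have T: "0 \<le> T" using ab by simp
  have vv': "AE \<omega> in M. AE s\<in>{0..T} in lborel. v' s \<omega> = v s \<omega> + \<epsilon> * indicator {a<..b} s"
    using v(2) v'(2) AE_space
  proof eventually_elim
    case (elim \<omega>)
    show ?case
    proof (rule AE_eq_if_indefinite_integral_eq)
      show "set_integrable lborel {0..T} (\<lambda>s. v' s \<omega>)" using elim(2) by (rule conjunct1)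
      have iv: "set_integrable lborel {0..T} (\<lambda>s. v s \<omega>)" using elim(1) by (rule conjunct1)
      show "set_integrable lborel {0..T} (\<lambda>s. v s \<omega> + \<epsilon> * indicator {a<..b} s)" 
        by (rule set_integral_add(1)[OF iv step(1)[OF T]])
      fix t assume t: "t \<in> {0..T}"
      then have t0: "0 \<le> t" by simp
      have ut: "u t \<omega> = (LINT s:{0..t}|lborel. v s \<omega>)" "w t \<omega> = (LINT s:{0..t}|lborel. v' s \<omega>)"
        using elim(1,2) t by blast+
      have "set_integrable lborel {0..t} (\<lambda>s. v s \<omega>)"
        by (rule set_integrable_subset[OF iv]) (use t in auto)
      then have "(LINT s:{0..t}|lborel. v s \<omega> + \<epsilon> * indicator {a<..b} s) 
          = (LINT s:{0..t}|lborel. v s \<omega>) + (LINT s:{0..t}|lborel. \<epsilon> * indicator {a<..b} s)"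
        by (rule set_integral_add(2)[OF _ step(1)[OF t0]])
      also have "\<dots> = w t \<omega>" unfolding step(2)[OF t0] shift[OF t elim(3)] ut(1) ..
      also have "\<dots> = (LINT s:{0..t}|lborel. v' s \<omega>)" by (rule ut(2))
      finally show "(LINT s:{0..t}|lborel. v' s \<omega>) = (LINT s:{0..t}|lborel. v s \<omega> + \<epsilon> * indicator {a<..b} s)" ..
    qed
  qed
  have "AE \<omega> in M. ito_integral M F T X v' \<omega> = ito_integral M F T X v \<omega> + \<epsilon> * (X b \<omega> - X a \<omega>)"
    by (rule ito_integral_step_shift[OF v(3) v'(3) v(1) v'(1) ab vv'])
  then show ?thesis
    using vv' v(2) v'(2)
  proof eventually_elim
    case (elim \<omega>)
    have i: "set_integrable lborel {0..T} (\<lambda>s. v s \<omega>)" "set_integrable lborel {0..T} (\<lambda>s. (v s \<omega>)\<^sup>2)"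
        "set_integrable lborel {0..T} (\<lambda>s. (v' s \<omega>)\<^sup>2)" 
      using elim(3,4) by blast+
    have uab: "u a \<omega> = (LINT s:{0..a}|lborel. v s \<omega>)" "u b \<omega> = (LINT s:{0..b}|lborel. v s \<omega>)"
      using elim(3) ab by auto
    have iab: "set_integrable lborel {0..a} (\<lambda>s. v s \<omega>)" "set_integrable lborel {a<..b} (\<lambda>s. v s \<omega>)"
      using ab by (auto intro!: set_integrable_subset[OF i(1)])
    have "{0..b} = {0..a} \<union> {a<..b}" "{0..a} \<inter> {a<..b} = {}" using ab by auto
    then have "(LINT s:{0..b}|lborel. v s \<omega>) = (LINT s:{0..a}|lborel. v s \<omega>) + (LINT s:{a<..b}|lborel. v s \<omega>)"
      using set_integral_Un[OF _ iab] by simp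
    then have inc: "(LINT s:{a<..b}|lborel. v s \<omega>) = u b \<omega> - u a \<omega>"
      unfolding uab by simp
    have cross: "set_integrable lborel {0..T} (\<lambda>s. v s \<omega> * indicator {a<..b} s)"
      "(LINT s:{0..T}|lborel. v s \<omega> * indicator {a<..b} s) = u b \<omega> - u a \<omega>"
    proof -
      have e: "(\<lambda>s. indicator {0..T} s *\<^sub>R (v s \<omega> * indicator {a<..b} s)) = (\<lambda>s. indicator {a<..b} s *\<^sub>R v s \<omega>)"
        using ab by (auto simp: indicator_def)
      show "set_integrable lborel {0..T} (\<lambda>s. v s \<omega> * indicator {a<..b} s)"
        using iab(2) unfolding set_integrable_def e .
      show "(LINT s:{0..T}|lborel. v s \<omega> * indicator {a<..b} s) = u b \<omega> - u a \<omega>"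
        using inc unfolding set_lebesgue_integral_def e .
    qed
    have st: "set_integrable lborel {0..T} (\<lambda>s. \<epsilon>\<^sup>2 * indicator {a<..b} s)"
     "(LINT s:{0..T}|lborel. \<epsilon>\<^sup>2 * indicator {a<..b} s) = \<epsilon>\<^sup>2 * (b - a)"
      using interval_step_integral[OF ab(1,2) T, of "\<epsilon>\<^sup>2"] ab by auto
    have sqe: "(v s \<omega> + \<epsilon> * indicator {a<..b} s)\<^sup>2 
        = (v s \<omega>)\<^sup>2 + 2 * \<epsilon> * (v s \<omega> * indicator {a<..b} s) + \<epsilon>\<^sup>2 * indicator {a<..b} s" for s
      by (auto simp: indicator_def power2_eq_square algebra_simps)
    have rhs: "set_integrable lborel {0..T} (\<lambda>s. (v s \<omega> + \<epsilon> * indicator {a<..b} s)\<^sup>2)"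
      "(LINT s:{0..T}|lborel. (v s \<omega> + \<epsilon> * indicator {a<..b} s)\<^sup>2) 
        = (LINT s:{0..T}|lborel. (v s \<omega>)\<^sup>2) + 2 * \<epsilon> * (u b \<omega> - u a \<omega>) + \<epsilon>\<^sup>2 * (b - a)"
      unfolding sqe using i(2) cross st by (simp_all add: set_integral_add)
    have "(LINT s:{0..T}|lborel. (v' s \<omega>)\<^sup>2) = (LINT s:{0..T}|lborel. (v s \<omega> + \<epsilon> * indicator {a<..b} s)\<^sup>2)"
      unfolding set_lebesgue_integral_def
    proof (rule integral_cong_AE)
      show "AE s in lborel. indicator {0..T} s *\<^sub>R (v' s \<omega>)\<^sup>2 = indicator {0..T} s *\<^sub>R (v s \<omega> + \<epsilon> * indicator {a<..b} s)\<^sup>2"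
        using elim(2) by eventually_elim (auto simp: indicator_def)
    qed (use i(3) rhs(1) in \<open>auto simp: set_integrable_def\<close>)
    then show ?case
      unfolding girsanov_density_def v_def[symmetric] v'_def[symmetric] rhs(2) elim(1)
      by (simp flip: exp_add) (simp add: field_simps)
  qed
qed

end

section \<open>The information inequality for increments\<close>

text \<open>The Cramer--Rao bound in the finite-difference form of Chapman and Robbins. The variable \<open>(R \<epsilon> - 1) / \<epsilon>\<close>
  is a difference quotient approximating the score \<open>D\<close>; the optimal \<open>Z\<close> is the score itself, which is why
  \<open>Z\<close> is compared with it. No Gaussian integral has to be evaluated: the second moment of \<open>R \<epsilon>\<close>
  follows from \<open>R \<epsilon>\<^sup>2 = exp (\<epsilon>\<^sup>2 \<tau>) R (2 \<epsilon>)\<close> and the normalisation of \<open>R (2 \<epsilon>)\<close>.\<close>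

lemma gaussian_shift_information_bound:
  fixes D Z :: "'a \<Rightarrow> real" and \<tau> :: real
  defines "R \<equiv> \<lambda>\<epsilon> \<omega>. exp (\<epsilon> * D \<omega> - \<epsilon>\<^sup>2 * \<tau> / 2)"
  assumes "prob_space P" and "0 \<le> \<tau>"
    and R: "\<And>\<epsilon>. integrable P (R \<epsilon>)" "\<And>\<epsilon>. (LINT \<omega>|P. R \<epsilon> \<omega>) = 1"
    and ZR: "\<And>\<epsilon>. integrable P (\<lambda>\<omega>. R \<epsilon> \<omega> * Z \<omega>)" "\<And>\<epsilon>. (LINT \<omega>|P. R \<epsilon> \<omega> * Z \<omega>) = \<epsilon> * \<tau>"
  shows "ennreal \<tau> \<le> (\<integral>\<^sup>+\<omega>. ennreal ((Z \<omega>)\<^sup>2) \<partial>P)"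
proof (cases "(\<integral>\<^sup>+\<omega>. ennreal ((Z \<omega>)\<^sup>2) \<partial>P) = \<infinity> \<or> \<tau> = 0")
  case False
  interpret prob_space P by fact
  have \<tau>: "0 < \<tau>" using False \<open>0 \<le> \<tau>\<close> by auto
  \<comment> \<open>At \<open>\<epsilon> = 0\<close> the assumptions say that \<open>Z\<close> is integrable with mean zero.\<close>
  have R0: "R 0 = (\<lambda>\<omega>. 1)" by (simp add: R_def)
  have Z1: "integrable P Z" "expectation Z = 0" using ZR[of 0] by (auto simp: R0)
  have Z2: "integrable P (\<lambda>\<omega>. (Z \<omega>)\<^sup>2)"
    using Z1(1) False by (intro integrableI_bounded) (auto simp: less_top)
  have R2: "(\<lambda>\<omega>. (R \<epsilon> \<omega>)\<^sup>2) = (\<lambda>\<omega>. exp (\<epsilon>\<^sup>2 * \<tau>) * R (2 * \<epsilon>) \<omega>)" for \<epsilon>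
    by (simp add: R_def exp_double[symmetric] flip: exp_add) (simp add: field_simps)
  have bound: "2 * \<tau> - (exp (\<epsilon>\<^sup>2 * \<tau>) - 1) / \<epsilon>\<^sup>2 \<le> expectation (\<lambda>\<omega>. (Z \<omega>)\<^sup>2)" if "\<epsilon> > 0" for \<epsilon>
  proof -
    have e: "(Z \<omega> - (R \<epsilon> \<omega> - 1) / \<epsilon>)\<^sup>2 = (Z \<omega>)\<^sup>2 - (2 / \<epsilon>) * (R \<epsilon> \<omega> * Z \<omega>) + (2 / \<epsilon>) * Z \<omega>
       + (1 / \<epsilon>\<^sup>2) * ((R \<epsilon> \<omega>)\<^sup>2 - 2 * R \<epsilon> \<omega> + 1)" for \<omega>
      using that by (simp add: power2_eq_square field_simps)
    have iR2: "integrable P (\<lambda>\<omega>. (R \<epsilon> \<omega>)\<^sup>2)" "expectation (\<lambda>\<omega>. (R \<epsilon> \<omega>)\<^sup>2) = exp (\<epsilon>\<^sup>2 * \<tau>)"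
      unfolding R2 using R by simp_all
    have "0 \<le> expectation (\<lambda>\<omega>. (Z \<omega> - (R \<epsilon> \<omega> - 1) / \<epsilon>)\<^sup>2)" by simp
    also have "\<dots> = expectation (\<lambda>\<omega>. (Z \<omega>)\<^sup>2) - (2 / \<epsilon>) * (\<epsilon> * \<tau>) + (1 / \<epsilon>\<^sup>2) * (exp (\<epsilon>\<^sup>2 * \<tau>) - 2 + 1)"
      unfolding e using Z1 Z2 ZR[of \<epsilon>] R[of \<epsilon>] iR2 by (simp add: prob_space)
    finally show ?thesis using that by (simp add: field_simps)
  qed
  have "\<tau> \<le> expectation (\<lambda>\<omega>. (Z \<omega>)\<^sup>2)"
  proof (rule field_le_epsilon)
    fix e :: real assume "0 < e"
    \<comment> \<open>\<open>x\<close> plays the role of \<open>\<epsilon>\<^sup>2\<close>, small enough for \<open>exp y \<le> 1 + y + y\<^sup>2\<close> at \<open>y = x \<tau>\<close> and for an error of at most \<open>e\<close>.\<close>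
    define x where "x = min (1 / \<tau>) (e / \<tau>\<^sup>2)"
    have x: "0 < x" "x * \<tau> \<le> 1" "x * \<tau>\<^sup>2 \<le> e"
      using \<tau> \<open>0 < e\<close> by (auto simp: x_def min_def field_simps)
    have "exp (x * \<tau>) \<le> 1 + x * \<tau> + (x * \<tau>)\<^sup>2"
      using x \<tau> by (intro exp_bound) auto
    then have "(exp (x * \<tau>) - 1) / x \<le> \<tau> + x * \<tau>\<^sup>2"
      using x by (simp add: field_simps power2_eq_square)
    moreover have "2 * \<tau> - (exp (x * \<tau>) - 1) / x \<le> expectation (\<lambda>\<omega>. (Z \<omega>)\<^sup>2)"
      using bound[of "sqrt x"] x by simp
    ultimately show "\<tau> \<le> expectation (\<lambda>\<omega>. (Z \<omega>)\<^sup>2) + e" using x by linarith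
  qed
  then show ?thesis
    using Z2 by (simp add: nn_integral_eq_integral)
qed auto

context filtered_brownian
begin

lemma girsanov_shifted_brownian:
  assumes "girsanov_drift M F T X u"
  shows "filtered_brownian (girsanov_measure M F T X u) F T (\<lambda>t \<omega>. X t \<omega> - u t \<omega>)"
proof
  show "brownian_motion (girsanov_measure M F T X u) F T (\<lambda>t \<omega>. X t \<omega> - u t \<omega>)"
    using assms by (simp add: girsanov_drift_def)
  have "prob_space (girsanov_measure M F T X u)" using assms by (simp add: girsanov_drift_def)
  then show "filtered_prob_space (girsanov_measure M F T X u) F T"
    using filtered by (simp add: filtered_prob_space_def subalgebra_def girsanov_measure_def)
qed

text \<open>Both the normalisation of the likelihood ratio \<open>R \<epsilon>\<close> and the value of its correlation with \<open>Z\<close> come from the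
  perturbed drift \<open>w \<in> \<Theta>\<close>: the first because its Girsanov measure is a probability, the second because
  \<open>\<xi>\<close> is unbiased at \<open>w\<close> and \<open>w\<^sub>b - w\<^sub>a = u\<^sub>b - u\<^sub>a + \<epsilon> (b - a)\<close>.\<close>

lemma risk_increment_lower_bound:
  assumes \<Theta>: "drift_parameter_space M F T X \<Theta>" and \<xi>: "unbiased_drift_estimator M F T X \<Theta> \<xi>"
    and "u \<in> \<Theta>" and ab: "0 \<le> a" "a \<le> b" "b \<le> T"
  shows "ennreal (b - a) \<le> 
    (\<integral>\<^sup>+\<omega>. ennreal (((\<xi> b \<omega> - u b \<omega>) - (\<xi> a \<omega> - u a \<omega>))\<^sup>2) \<partial>girsanov_measure M F T X u)"
proof -
  let ?P = "girsanov_measure M F T X"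
  define D where "D \<omega> = (X b \<omega> - u b \<omega>) - (X a \<omega> - u a \<omega>)" for \<omega>
  define R where "R \<epsilon> \<omega> = exp (\<epsilon> * D \<omega> - \<epsilon>\<^sup>2 * (b - a) / 2)" for \<epsilon> \<omega>
  define Z where "Z \<omega> = (\<xi> b \<omega> - u b \<omega>) - (\<xi> a \<omega> - u a \<omega>)" for \<omega>
  have gir: "girsanov_drift M F T X w" if "w \<in> \<Theta>" for w
    using \<Theta> that by (simp add: drift_parameter_space_def)
  have iw: "integrable (?P w) (w t)" if "w \<in> \<Theta>" "t \<in> {0..T}" for w t
    using \<Theta> that by (simp add: drift_parameter_space_def)
  have i\<xi>: "integrable (?P w) (\<xi> t)" "(LINT \<omega>|?P w. \<xi> t \<omega>) = (LINT \<omega>|?P w. w t \<omega>)" if "w \<in> \<Theta>" "t \<in> {0..T}" for w t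
    using \<xi> that by (auto simp: unbiased_drift_estimator_def)
  have prob: "prob_space (?P w)" if "w \<in> \<Theta>" for w
    using gir[OF that] by (simp add: girsanov_drift_def)
  have t: "a \<in> {0..T}" "b \<in> {0..T}" using ab by auto
  have sp: "sets (?P u) = sets M" "space (?P u) = space M" by (simp_all add: girsanov_measure_def)
  have um: "u a \<in> borel_measurable M" "u b \<in> borel_measurable M"
    using gir[OF \<open>u \<in> \<Theta>\<close>] t by (auto simp: girsanov_drift_def intro: measurable_process_at)
  have \<xi>m: "\<xi> a \<in> borel_measurable M" "\<xi> b \<in> borel_measurable M"
    using \<xi> t by (auto simp: unbiased_drift_estimator_def intro: measurable_process_at)
  have [measurable]: "D \<in> borel_measurable M"
    unfolding D_def using um X_measurable[of a] X_measurable[of b] ab by auto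
  have [measurable]: "Z \<in> borel_measurable M"
    unfolding Z_def using um \<xi>m by auto
  have [measurable]: "R \<epsilon> \<in> borel_measurable M" for \<epsilon>
    unfolding R_def by measurable
  note m_u = measurable_cong_sets[OF sp(1) refl]
  have shifted: "\<exists>w\<in>\<Theta>. ?P w = density (?P u) (\<lambda>\<omega>. ennreal (R \<epsilon> \<omega>)) \<and>
      (\<forall>t\<in>{0..T}. \<forall>\<omega>\<in>space M. w t \<omega> = u t \<omega> + \<epsilon> * (min t b - min t a))" for \<epsilon>
  proof -
    obtain w where w: "w \<in> \<Theta>" "\<forall>t\<in>{0..T}. \<forall>\<omega>\<in>space M. w t \<omega> = u t \<omega> + \<epsilon> * (min t b - min t a)"
    proof -
      have "\<forall>h\<in>H10 T. \<exists>w\<in>\<Theta>. \<forall>t\<in>{0..T}. \<forall>\<omega>\<in>space M. w t \<omega> = u t \<omega> + h t"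
        using \<Theta> \<open>u \<in> \<Theta>\<close> by (simp add: drift_parameter_space_def)
      from bspec[OF this ramp_in_H10[OF ab, of \<epsilon>]] show thesis using that by blast
    qed
    have "AE \<omega> in M. girsanov_density M F T X w \<omega> = girsanov_density M F T X u \<omega> * R \<epsilon> \<omega>"
      unfolding R_def D_def
      by (rule girsanov_density_ramp_shift[OF gir[OF \<open>u \<in> \<Theta>\<close>] gir[OF w(1)] ab]) (use w(2) in blast)
    then have "?P w = density M (\<lambda>\<omega>. ennreal (girsanov_density M F T X u \<omega>) * ennreal (R \<epsilon> \<omega>))"
      unfolding girsanov_measure_def 
      using girsanov_density_measurable[OF gir[OF \<open>u \<in> \<Theta>\<close>]] girsanov_density_measurable[OF gir[OF w(1)]]
      by (intro density_cong) (auto simp: ennreal_mult'' R_def)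
    also have "\<dots> = density (?P u) (\<lambda>\<omega>. ennreal (R \<epsilon> \<omega>))"
      unfolding girsanov_measure_def 
      using girsanov_density_measurable[OF gir[OF \<open>u \<in> \<Theta>\<close>]]
      by (intro density_density_eq[symmetric]) auto
    finally show ?thesis using w by blast
  qed
  have tilt: "integrable (?P u) (R \<epsilon>) \<and> (LINT \<omega>|?P u. R \<epsilon> \<omega>) = 1 \<and>
    integrable (?P u) (\<lambda>\<omega>. R \<epsilon> \<omega> * Z \<omega>) \<and> (LINT \<omega>|?P u. R \<epsilon> \<omega> * Z \<omega>) = \<epsilon> * (b - a)" for \<epsilon>
  proof -
    obtain w where w: "w \<in> \<Theta>" and Pw: "?P w = density (?P u) (\<lambda>\<omega>. ennreal (R \<epsilon> \<omega>))"
      and wt: "\<And>t \<omega>. t \<in> {0..T} \<Longrightarrow> \<omega> \<in> space M \<Longrightarrow> w t \<omega> = u t \<omega> + \<epsilon> * (min t b - min t a)"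
      using shifted[of \<epsilon>] by blast
    interpret Pw: prob_space "?P w" by (rule prob[OF w])
    have Rm: "R \<epsilon> \<in> borel_measurable (?P u)" "Z \<in> borel_measurable (?P u)" unfolding m_u by simp_all
    have nn: "AE \<omega> in ?P u. 0 \<le> R \<epsilon> \<omega>" by (simp add: R_def)
    have int: "integrable (?P w) f \<longleftrightarrow> integrable (?P u) (\<lambda>\<omega>. R \<epsilon> \<omega> * f \<omega>)"
       "(LINT \<omega>|?P w. f \<omega>) = (LINT \<omega>|?P u. R \<epsilon> \<omega> * f \<omega>)" if "f \<in> borel_measurable (?P u)" for f :: "'a \<Rightarrow> real"
      unfolding Pw using integrable_real_density[OF Rm(1) nn that] integral_real_density[OF Rm(1) nn that] by auto
    have one: "integrable (?P u) (R \<epsilon>)" "(LINT \<omega>|?P u. R \<epsilon> \<omega>) = 1"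
      using int[of "\<lambda>_. 1"] Pw.prob_space by auto
    have Zeq: "Z \<omega> = (\<xi> b \<omega> - w b \<omega>) - (\<xi> a \<omega> - w a \<omega>) + \<epsilon> * (b - a)" if "\<omega> \<in> space (?P w)" for \<omega>
    proof -
      have "\<omega> \<in> space M" using that by (simp add: girsanov_measure_def)
      from wt[OF t(1) this] wt[OF t(2) this] show ?thesis using ab by (simp add: Z_def algebra_simps)
    qed
    have "integrable (?P w) (\<lambda>\<omega>. (\<xi> b \<omega> - w b \<omega>) - (\<xi> a \<omega> - w a \<omega>) + \<epsilon> * (b - a))"
      using i\<xi>(1)[OF w] iw[OF w] t by auto
    moreover have "(LINT \<omega>|?P w. (\<xi> b \<omega> - w b \<omega>) - (\<xi> a \<omega> - w a \<omega>) + \<epsilon> * (b - a)) = \<epsilon> * (b - a)"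
      using i\<xi>[OF w t(1)] i\<xi>[OF w t(2)] iw[OF w t(1)] iw[OF w t(2)] by (simp add: Pw.prob_space)
    moreover have "integrable (?P w) Z \<longleftrightarrow> integrable (?P w) (\<lambda>\<omega>. (\<xi> b \<omega> - w b \<omega>) - (\<xi> a \<omega> - w a \<omega>) + \<epsilon> * (b - a))"
      by (rule Bochner_Integration.integrable_cong[OF refl]) (rule Zeq)
    moreover have "(LINT \<omega>|?P w. Z \<omega>) = (LINT \<omega>|?P w. (\<xi> b \<omega> - w b \<omega>) - (\<xi> a \<omega> - w a \<omega>) + \<epsilon> * (b - a))"
      by (rule Bochner_Integration.integral_cong[OF refl]) (rule Zeq)
    ultimately have "integrable (?P w) Z" "(LINT \<omega>|?P w. Z \<omega>) = \<epsilon> * (b - a)" by simp_all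
    then show ?thesis using one int[OF Rm(2)] by auto
  qed
  show ?thesis
    using gaussian_shift_information_bound[OF prob[OF \<open>u \<in> \<Theta>\<close>], of "b - a" D Z] tilt ab
    unfolding R_def Z_def by auto
qed

end

section \<open>The averaged Sobolev energy\<close>

text \<open>Two applications of Fubini's theorem move the expectation inside, which reduces bounds on the risk to
  bounds on mean square increments.\<close>

lemma nn_integral_sobolev_energy:
  assumes "sigma_finite_measure P" and Y: "measurable_process P T Y"
  shows "(\<integral>\<^sup>+\<omega>. sobolev_energy T \<alpha> (\<lambda>t. Y t \<omega>) \<partial>P) =
    (\<integral>\<^sup>+s\<in>{0..T}. (\<integral>\<^sup>+t\<in>{0..T}. (\<integral>\<^sup>+\<omega>. ennreal ((Y t \<omega> - Y s \<omega>)\<^sup>2) \<partial>P) *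
        ennreal (1 / \<bar>t - s\<bar> powr (2 * \<alpha> + 1)) \<partial>lborel) \<partial>lborel)"
proof -
  let ?N = "restrict_space lborel {0..T}"
  interpret P: sigma_finite_measure P by fact
  interpret N: sigma_finite_measure ?N by (rule sigma_finite_interval)
  interpret pair_sigma_finite P ?N ..
  define g where "g \<omega> s t = ennreal ((Y t \<omega> - Y s \<omega>)\<^sup>2) * ennreal (1 / \<bar>t - s\<bar> powr (2 * \<alpha> + 1))" for \<omega> s t
  have Ym: "(\<lambda>x. Y (snd x) (fst x)) \<in> borel_measurable (P \<Otimes>\<^sub>M ?N)"
    using Y unfolding measurable_process_lborel by (simp add: case_prod_beta')
  have idm: "(\<lambda>x. x) \<in> borel_measurable ?N"
    by (rule measurable_restrict_space1) simp
  have gm: "(\<lambda>x. g (fst (fst x)) (snd (fst x)) (snd x)) \<in> borel_measurable ((P \<Otimes>\<^sub>M ?N) \<Otimes>\<^sub>M ?N)"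
  proof -
    have [measurable]: "(\<lambda>x. Y (snd (fst x)) (fst (fst x))) \<in> borel_measurable ((P \<Otimes>\<^sub>M ?N) \<Otimes>\<^sub>M ?N)"
      by (rule measurable_compose[OF measurable_fst Ym])
    have "(\<lambda>x. (fst (fst x), snd x)) \<in> measurable ((P \<Otimes>\<^sub>M ?N) \<Otimes>\<^sub>M ?N) (P \<Otimes>\<^sub>M ?N)"
      by measurable
    from measurable_compose[OF this Ym]
    have [measurable]: "(\<lambda>x. Y (snd x) (fst (fst x))) \<in> borel_measurable ((P \<Otimes>\<^sub>M ?N) \<Otimes>\<^sub>M ?N)" by simp
    have [measurable]: "(\<lambda>x. snd x) \<in> borel_measurable ((P \<Otimes>\<^sub>M ?N) \<Otimes>\<^sub>M ?N)"
      by (rule measurable_compose[OF measurable_snd idm])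
    have [measurable]: "(\<lambda>x. snd (fst x)) \<in> borel_measurable ((P \<Otimes>\<^sub>M ?N) \<Otimes>\<^sub>M ?N)"
      by (rule measurable_compose[OF measurable_fst measurable_compose[OF measurable_snd idm]])
    show ?thesis unfolding g_def by measurable
  qed
  have gm2: "(\<lambda>x. g (fst x) s (snd x)) \<in> borel_measurable (P \<Otimes>\<^sub>M ?N)" if "s \<in> space ?N" for s
  proof -
    have "(\<lambda>x. ((fst x, s), snd x)) \<in> measurable (P \<Otimes>\<^sub>M ?N) ((P \<Otimes>\<^sub>M ?N) \<Otimes>\<^sub>M ?N)"
      using that by measurable
    from measurable_compose[OF this gm] show ?thesis by simp
  qed
  have "(\<integral>\<^sup>+\<omega>. sobolev_energy T \<alpha> (\<lambda>t. Y t \<omega>) \<partial>P) = (\<integral>\<^sup>+\<omega>. \<integral>\<^sup>+s. \<integral>\<^sup>+t. g \<omega> s t \<partial>?N \<partial>?N \<partial>P)"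
    unfolding sobolev_energy_def nn_integral_interval g_def
    by (intro nn_integral_cong) (simp add: ennreal_mult'[symmetric])
  also have "\<dots> = (\<integral>\<^sup>+s. \<integral>\<^sup>+\<omega>. \<integral>\<^sup>+t. g \<omega> s t \<partial>?N \<partial>P \<partial>?N)"
    by (rule Fubini'[symmetric]) (use N.borel_measurable_nn_integral_fst[OF gm] in \<open>simp add: case_prod_beta'\<close>)
  also have "\<dots> = (\<integral>\<^sup>+s. \<integral>\<^sup>+t. \<integral>\<^sup>+\<omega>. g \<omega> s t \<partial>P \<partial>?N \<partial>?N)"
    by (intro nn_integral_cong Fubini'[symmetric]) (use gm2 in \<open>simp add: case_prod_beta'\<close>)
  also have "\<dots> = (\<integral>\<^sup>+s. \<integral>\<^sup>+t. (\<integral>\<^sup>+\<omega>. ennreal ((Y t \<omega> - Y s \<omega>)\<^sup>2) \<partial>P) *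
        ennreal (1 / \<bar>t - s\<bar> powr (2 * \<alpha> + 1)) \<partial>?N \<partial>?N)"
  proof (intro nn_integral_cong)
    fix s t assume "s \<in> space ?N" "t \<in> space ?N"
    then have "Y s \<in> borel_measurable P" "Y t \<in> borel_measurable P"
      by (auto intro!: measurable_process_at[OF Y] simp: space_restrict_space)
    then show "(\<integral>\<^sup>+\<omega>. g \<omega> s t \<partial>P) = (\<integral>\<^sup>+\<omega>. ennreal ((Y t \<omega> - Y s \<omega>)\<^sup>2) \<partial>P) *
        ennreal (1 / \<bar>t - s\<bar> powr (2 * \<alpha> + 1))"
      unfolding g_def by (intro nn_integral_multc) measurable
  qed
  finally show ?thesis unfolding nn_integral_interval .
qed

text \<open>On the diagonal both sides vanish because of the conventions for division by zero.\<close>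

lemma sobolev_weight_times_distance:
  fixes s t :: real
  shows "ennreal \<bar>t - s\<bar> * ennreal (1 / \<bar>t - s\<bar> powr (2 * \<alpha> + 1)) = ennreal (1 / \<bar>t - s\<bar> powr (2 * \<alpha>))"
proof (cases "s = t")
  case False
  then have "\<bar>t - s\<bar> * (1 / \<bar>t - s\<bar> powr (2 * \<alpha> + 1)) = 1 / \<bar>t - s\<bar> powr (2 * \<alpha>)"
    by (simp add: powr_add)
  then show ?thesis by (simp add: ennreal_mult'[symmetric])
qed simp

theorem theorem2p9:
  fixes M :: "'a measure" and F :: "real \<Rightarrow> 'a measure" and T :: real
    and X :: "real \<Rightarrow> 'a \<Rightarrow> real" and \<Theta> :: "(real \<Rightarrow> 'a \<Rightarrow> real) set"
  assumes "T > 0"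
    and "filtered_prob_space M F T"
    and "brownian_motion M F T X"
    and "drift_parameter_space M F T X \<Theta>"
  shows "(\<forall>\<xi>. unbiased_drift_estimator M F T X \<Theta> \<xi> \<longrightarrow>
            (\<forall>\<alpha>\<in>{0<..<1}. \<forall>u\<in>\<Theta>.
               drift_risk M F T X \<alpha> \<xi> u \<ge>
               (\<integral>\<^sup>+s\<in>{0..T}. (\<integral>\<^sup>+t\<in>{0..T}. ennreal (1 / \<bar>t - s\<bar> powr (2 * \<alpha>)) \<partial>lborel) \<partial>lborel)))
       \<and> unbiased_drift_estimator M F T X \<Theta> X
       \<and> (\<forall>\<alpha>\<in>{0<..<1}. \<forall>u\<in>\<Theta>.
               drift_risk M F T X \<alpha> X u =
               (\<integral>\<^sup>+s\<in>{0..T}. (\<integral>\<^sup>+t\<in>{0..T}. ennreal (1 / \<bar>t - s\<bar> powr (2 * \<alpha>)) \<partial>lborel) \<partial>lborel))"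
proof -
  interpret filtered_brownian M F T X using assms by unfold_locales
  let ?P = "girsanov_measure M F T X"
  have gir: "girsanov_drift M F T X u" if "u \<in> \<Theta>" for u
    using assms(4) that by (simp add: drift_parameter_space_def)
  have Xmeas: "measurable_process M T X"
    using assms(3) by (simp add: brownian_motion_def)
  have risk: "drift_risk M F T X \<alpha> \<xi> u = (\<integral>\<^sup>+s\<in>{0..T}. (\<integral>\<^sup>+t\<in>{0..T}. 
        (\<integral>\<^sup>+\<omega>. ennreal (((\<xi> t \<omega> - u t \<omega>) - (\<xi> s \<omega> - u s \<omega>))\<^sup>2) \<partial>?P u) *
        ennreal (1 / \<bar>t - s\<bar> powr (2 * \<alpha> + 1)) \<partial>lborel) \<partial>lborel)"
    if "u \<in> \<Theta>" "measurable_process M T \<xi>" for \<xi> u \<alpha>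
  proof -
    interpret P: prob_space "?P u" using gir[OF that(1)] by (simp add: girsanov_drift_def)
    have "sets (?P u) = sets M" by (simp add: girsanov_measure_def)
    then have "sets (?P u \<Otimes>\<^sub>M restrict_space borel {0..T}) = sets (M \<Otimes>\<^sub>M restrict_space borel {0..T})"
      by (rule sets_pair_measure_cong) (rule refl)
    from measurable_cong_sets[OF this refl, of "borel :: real measure"]
    have "measurable_process (?P u) T Y = measurable_process M T Y" for Y
      unfolding measurable_process_def by simp
    then have "measurable_process (?P u) T (\<lambda>t \<omega>. \<xi> t \<omega> - u t \<omega>)"
      using measurable_process_diff[OF that(2)] gir[OF that(1)] by (simp add: girsanov_drift_def)
    from nn_integral_sobolev_energy[OF P.sigma_finite_measure_axioms this] show ?thesis
      unfolding drift_risk_def .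
  qed
  have lower: "drift_risk M F T X \<alpha> \<xi> u \<ge>
      (\<integral>\<^sup>+s\<in>{0..T}. (\<integral>\<^sup>+t\<in>{0..T}. ennreal (1 / \<bar>t - s\<bar> powr (2 * \<alpha>)) \<partial>lborel) \<partial>lborel)"
    if "unbiased_drift_estimator M F T X \<Theta> \<xi>" "u \<in> \<Theta>" for \<xi> u \<alpha>
  proof -
    have inc: "ennreal \<bar>t - s\<bar> \<le> (\<integral>\<^sup>+\<omega>. ennreal (((\<xi> t \<omega> - u t \<omega>) - (\<xi> s \<omega> - u s \<omega>))\<^sup>2) \<partial>?P u)"
      if st: "s \<in> {0..T}" "t \<in> {0..T}" for s t
    proof (cases "s \<le> t")
      case True
      then show ?thesis 
        using risk_increment_lower_bound[OF assms(4) \<open>unbiased_drift_estimator M F T X \<Theta> \<xi>\<close> \<open>u \<in> \<Theta>\<close>, of s t] st by simp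
    next
      case False
      then show ?thesis 
        using risk_increment_lower_bound[OF assms(4) \<open>unbiased_drift_estimator M F T X \<Theta> \<xi>\<close> \<open>u \<in> \<Theta>\<close>, of t s] st 
        by (simp add: power2_commute[of "_ - _" "_ - _"])
    qed
    have "measurable_process M T \<xi>" using that by (simp add: unbiased_drift_estimator_def)
    note r = risk[OF that(2) this]
    show ?thesis
      unfolding r nn_integral_interval sobolev_weight_times_distance[symmetric]
      by (intro nn_integral_mono mult_right_mono inc) (auto simp: space_restrict_space)
  qed
  have X_unbiased: "unbiased_drift_estimator M F T X \<Theta> X"
    unfolding unbiased_drift_estimator_def
  proof (intro conjI ballI)
    fix u t assume u: "u \<in> \<Theta>" and t: "t \<in> {0..T}"
    interpret P: filtered_brownian "?P u" F T "\<lambda>t \<omega>. X t \<omega> - u t \<omega>"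
      by (rule girsanov_shifted_brownian[OF gir[OF u]])
    have ut: "integrable (?P u) (u t)" 
      using assms(4) u t by (simp add: drift_parameter_space_def)
    have inc: "integrable (?P u) (\<lambda>\<omega>. (X t \<omega> - u t \<omega>) - (X 0 \<omega> - u 0 \<omega>))"
        "(LINT \<omega>|?P u. (X t \<omega> - u t \<omega>) - (X 0 \<omega> - u 0 \<omega>)) = 0"
      using P.integrable_increment[of 0 t] P.expectation_increment[of 0 t] t by auto
    have "AE \<omega> in ?P u. X 0 \<omega> - u 0 \<omega> = 0"
      using P.brownian by (simp add: brownian_motion_def)
    then have ae: "AE \<omega> in ?P u. (X t \<omega> - u t \<omega>) - (X 0 \<omega> - u 0 \<omega>) + u t \<omega> = X t \<omega>"
      by eventually_elim simp
    have Xm: "X t \<in> borel_measurable (?P u)"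
      using X_measurable[of t] t by (simp add: girsanov_measure_def)
    have s: "integrable (?P u) (\<lambda>\<omega>. (X t \<omega> - u t \<omega>) - (X 0 \<omega> - u 0 \<omega>) + u t \<omega>)"
      using inc(1) ut by (rule Bochner_Integration.integrable_add)
    show "integrable (?P u) (X t)"
      using integrable_cong_AE_imp[OF s Xm] ae by auto
    have "(LINT \<omega>|?P u. X t \<omega>) = (LINT \<omega>|?P u. (X t \<omega> - u t \<omega>) - (X 0 \<omega> - u 0 \<omega>) + u t \<omega>)"
      using ae s Xm by (intro integral_cong_AE) auto
    also have "\<dots> = (LINT \<omega>|?P u. u t \<omega>)"
      using inc ut by (subst Bochner_Integration.integral_add) auto
    finally show "(LINT \<omega>|?P u. X t \<omega>) = (LINT \<omega>|?P u. u t \<omega>)" .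
  qed (rule Xmeas)
  have efficient: "drift_risk M F T X \<alpha> X u =
      (\<integral>\<^sup>+s\<in>{0..T}. (\<integral>\<^sup>+t\<in>{0..T}. ennreal (1 / \<bar>t - s\<bar> powr (2 * \<alpha>)) \<partial>lborel) \<partial>lborel)"
    if "u \<in> \<Theta>" for u \<alpha>
  proof -
    interpret P: filtered_brownian "?P u" F T "\<lambda>t \<omega>. X t \<omega> - u t \<omega>"
      by (rule girsanov_shifted_brownian[OF gir[OF that]])
    have *: "(\<integral>\<^sup>+\<omega>. ennreal (((X t \<omega> - u t \<omega>) - (X s \<omega> - u s \<omega>))\<^sup>2) \<partial>?P u) = ennreal (t - s)"
      if "0 \<le> s" "s \<le> t" "t \<le> T" for s t
      using P.integrable_increment_sq[OF that] P.expectation_increment_sq[OF that]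
      by (simp add: nn_integral_eq_integral)
    have inc: "(\<integral>\<^sup>+\<omega>. ennreal (((X t \<omega> - u t \<omega>) - (X s \<omega> - u s \<omega>))\<^sup>2) \<partial>?P u) = ennreal \<bar>t - s\<bar>"
      if "s \<in> {0..T}" "t \<in> {0..T}" for s t
    proof (cases "s \<le> t")
      case True
      then show ?thesis using *[of s t] that by simp
    next
      case False
      then show ?thesis using *[of t s] that by (simp add: power2_commute[of "_ - _" "_ - _"])
    qed
    show ?thesis
      unfolding risk[OF that Xmeas] nn_integral_interval sobolev_weight_times_distance[symmetric]
      by (intro nn_integral_cong) (simp add: inc space_restrict_space)
  qed
  show ?thesis using lower X_unbiased efficient by blast
qed

end
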